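(* As the natural numbers $m$ and $d$ vary in any way such that $\nu:=m/d\to\infty$, $$\frac{c_\infty}{\sqrt\nu}\ \sim\ \inf_L\sup_D\mathfrak R_m(L,D)\ \ge\ B_0(m,d)\ \ge\ B_1(\nu)\ \ge\ B_2(\nu)\ \ge\ \tilde B_2(\nu)\ \sim\ \frac{c_\infty}{\sqrt\nu},$$ where $\inf_L$ is either $\inf_{L\in\mathcal L}$ or $\inf_{L\in\mathcal L_{\mathsf{rand}}}$ (the assertion holds in both cases), $\sup_D$ is over all probability distributions $D$ on $[d]\times\{-1,1\}$, and $c_\infty:=\max_{z>0}\frac z2\big(1-\operatorname{erf}(z/\sqrt2)\big)=0.16997\dots$.
   Context: Setting: $\mathcal X=[d]=\{1,\dots,d\}$, $\mathcal Y=\{-1,1\}$, $\mathcal H=\mathcal Y^{\mathcal X}$. For a probability distribution $D$ on $\mathcal X\times\mathcal Y$, $(X^D,Y^D)$ is a random pair with distribution $D$, and $Z_m^D$ is the sequence of $m$ independent copies of it. Put $\operatorname{err}(h,D)=\mathsf P(h(X^D)\ne Y^D)$ and $\Delta(h,D)=\operatorname{err}(h,D)-\min_{g\in\mathcal H}\operatorname{err}(g,D)$. $\mathcal L$ is the set of all (non-randomized) learning algorithms, i.e. maps $L\colon(\mathcal X\times\mathcal Y)^m\to\mathcal H$; $\mathcal L_{\mathsf{rand}}$ is the set of all randomized learning algorithms, i.e. maps $L\colon(\mathcal X\times\mathcal Y)^m\times[-1,1]\to\mathcal H$ (measurable in the last argument). The expected excess risk is $\mathfrak R_m(L,D):=\mathsf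 E\,\Delta(L(Z_m^D),D)$ for $L\in\mathcal L$ and $\mathfrak R_m(L,D):=\mathsf E\,\Delta(L(Z_m^D,U),D)$ for $L\in\mathcal L_{\mathsf{rand}}$, with $U$ uniform on $[-1,1]$ and independent of $Z_m^D$. For $k\in\{0,1,\dots\}$ and $b\in[-1,1]$: $V^b_k:=Y^b_1+\dots+Y^b_k$, where the $Y^b_i$ are iid with $\mathsf P(Y^b_i=1)=\frac{1+b}2$, $\mathsf P(Y^b_i=-1)=\frac{1-b}2$ (so $V^b_0=0$); $s_k(b):=|\mathsf P(V^b_k>0)-\mathsf P(V^{-b}_k>0)|$; $\operatorname{bayes}(k,b):=\frac12\big(1-s_k(b)\big)$. For $b\in[0,1]$, $\kappa\mapsto\check{\operatorname{bayes}}(\kappa,b)$ on $[0,\infty)$ is the linear interpolation of $k\mapsto\operatorname{bayes}(k,b)$ at the points $0,1,3,5,\dots$: it equals $(1-\kappa)\operatorname{bayes}(0,b)+\kappa\operatorname{bayes}(1,b)$ for $0\le\kappa\le1$ and $\frac{2i+3-\kappa}2\operatorname{bayes}(2i+1,b)+\frac{\kappa-2i-1}2\operatorname{bayes}(2i+3,b)$ for $2i+1\le\kappa\le2i+3$, $i=0,1,\dots$. $\operatorname{erf}(u)=\frac2{\sqrt\pi}\int_0^ue^{-t^2}dt$; $z_*=0.75179\dots$ is the unique maximizer of $\frac z2(1-\operatorname{erf}(z/\sqrt2))$ over $z>0$; $i_\nu:=\lfloor\frac{\nu-1}2\rfloor$; $C_i:=\frac{\sqrt{\pi(i+1/2)}}{2^{2i}}\binom{2i}i$.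 The bounds are: $B_0(m,d):=\sup_{b\in[0,1]}b\,\mathsf E\operatorname{bayes}(N,b)$ with $N$ binomial with parameters $m$ and $1/d$; $B_1(\nu):=\sup_{b\in(0,1)}b\,\check{\operatorname{bayes}}(\nu,b)$; $B_2(\nu):=\frac1{\sqrt\nu}\,\frac{z_*}2\Big(1-C_{i_\nu}\frac{\operatorname{erf}(z_*/\sqrt2)}{\exp\{-z_*^2/(6\nu)\}}\Big)$ (for $\nu\ge1$); $\tilde B_2(\nu):=\frac1{\sqrt\nu}\,\frac{z_*}2\Big(1-\big(\frac{i_\nu+1}{i_\nu}\big)^{1/8}\frac{\operatorname{erf}(z_*/\sqrt2)}{\exp\{-z_*^2/(6\nu)\}}\Big)$ (for $\nu\ge3$). $A\sim B$ means $A/B\to1$; the inequalities are understood for $\nu$ large enough (namely $\nu\ge3$, so that all the bounds are defined). *)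

theory Defs
  imports "HOL-Probability.Probability"
begin

section \<open>Learning algorithms and their risk\<close>

text \<open>
  The size \<open>d\<close> of the domain varies in the asymptotic statement, so the domain is the explicit
  carrier \<open>{1..d}\<close> rather than a finite type.
\<close>

definition examples :: "nat \<Rightarrow> (nat \<times> int) set" where
  "examples d = {1..d} \<times> {-1, 1}"

definition hypotheses :: "nat \<Rightarrow> (nat \<Rightarrow> int) set" where
  "hypotheses d = {1..d} \<rightarrow>\<^sub>E {-1, 1}"

definition samples :: "nat \<Rightarrow> nat \<Rightarrow> (nat \<times> int) list set" where
  "samples m d = {z. length z = m \<and> set z \<subseteq> examples d}"

definition distributions :: "nat \<Rightarrow> (nat \<times> int) pmf set" where
  "distributions d = {D. set_pmf D \<subseteq> examples d}"

definition err :: "(nat \<Rightarrow> int) \<Rightarrow> (nat \<times> int) pmf \<Rightarrow> real" where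
  "err h D = measure_pmf.prob D {(x, y). h x \<noteq> y}"

definition excess :: "nat \<Rightarrow> (nat \<Rightarrow> int) \<Rightarrow> (nat \<times> int) pmf \<Rightarrow> real" where
  "excess d h D = err h D - (MIN g\<in>hypotheses d. err g D)"

definition learners :: "nat \<Rightarrow> nat \<Rightarrow> ((nat \<times> int) list \<Rightarrow> nat \<Rightarrow> int) set" where
  "learners m d = samples m d \<rightarrow> hypotheses d"

definition risk :: "nat \<Rightarrow> nat \<Rightarrow> ((nat \<times> int) list \<Rightarrow> nat \<Rightarrow> int) \<Rightarrow> (nat \<times> int) pmf \<Rightarrow> real" where
  "risk m d L D = measure_pmf.expectation (replicate_pmf m D) (\<lambda>z. excess d (L z) D)"

definition unif_sym :: "real measure" where
  "unif_sym = uniform_measure (restrict_space lborel {-1..1}) {-1..1}"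

definition rand_learners :: "nat \<Rightarrow> nat \<Rightarrow> ((nat \<times> int) list \<Rightarrow> real \<Rightarrow> nat \<Rightarrow> int) set" where
  "rand_learners m d =
     {L. \<forall>z\<in>samples m d. L z \<in> measurable unif_sym (count_space (hypotheses d))}"

text \<open>
  A randomized learning algorithm is unconstrained outside \<open>samples m d\<close> and \<open>{-1..1}\<close>.  The
  product law of \<open>(Z, U)\<close> is therefore taken on exactly this space: on a larger one the integrand
  could fail to be measurable, and the Bochner integral would then be 0 by convention.
\<close>

definition risk_rand ::
    "nat \<Rightarrow> nat \<Rightarrow> ((nat \<times> int) list \<Rightarrow> real \<Rightarrow> nat \<Rightarrow> int) \<Rightarrow> (nat \<times> int) pmf \<Rightarrow> real" where
  "risk_rand m d L D =
     (\<integral>(z, u). excess d (L z u) D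
        \<partial>(restrict_space (measure_pmf (replicate_pmf m D)) (samples m d) \<Otimes>\<^sub>M unif_sym))"

text \<open>
  For \<open>d \<ge> 1\<close> the index sets are nonempty and the risks lie in \<open>{0..1}\<close>, so the infima and
  suprema over the reals are the genuine ones.
\<close>

definition minimax :: "nat \<Rightarrow> nat \<Rightarrow> real" where
  "minimax m d = (INF L\<in>learners m d. SUP D\<in>distributions d. risk m d L D)"

definition minimax_rand :: "nat \<Rightarrow> nat \<Rightarrow> real" where
  "minimax_rand m d = (INF L\<in>rand_learners m d. SUP D\<in>distributions d. risk_rand m d L D)"


section \<open>The Bayes error\<close>

definition Y_pmf :: "real \<Rightarrow> int pmf" where
  "Y_pmf b = map_pmf (\<lambda>t. if t then 1 else -1) (bernoulli_pmf ((1 + b) / 2))"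

definition V_pmf :: "nat \<Rightarrow> real \<Rightarrow> int pmf" where
  "V_pmf k b = map_pmf sum_list (replicate_pmf k (Y_pmf b))"

definition s_gap :: "nat \<Rightarrow> real \<Rightarrow> real" where
  "s_gap k b = \<bar>measure_pmf.prob (V_pmf k b) {0<..} - measure_pmf.prob (V_pmf k (- b)) {0<..}\<bar>"

definition bayes :: "nat \<Rightarrow> real \<Rightarrow> real" where
  "bayes k b = (1 - s_gap k b) / 2"

text \<open>For \<open>1 \<le> \<nu>\<close>, this is the \<open>i\<close> with \<open>2 * i + 1 \<le> \<nu> < 2 * i + 3\<close>.\<close>

definition i_idx :: "real \<Rightarrow> nat" where
  "i_idx \<nu> = nat \<lfloor>(\<nu> - 1) / 2\<rfloor>"

definition bayes_interp :: "real \<Rightarrow> real \<Rightarrow> real" where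
  "bayes_interp \<kappa> b =
     (if \<kappa> \<le> 1 then (1 - \<kappa>) * bayes 0 b + \<kappa> * bayes 1 b
      else let i = i_idx \<kappa> in
        (2 * real i + 3 - \<kappa>) / 2 * bayes (2 * i + 1) b
        + (\<kappa> - 2 * real i - 1) / 2 * bayes (2 * i + 3) b)"


section \<open>The bounds\<close>

definition erf :: "real \<Rightarrow> real" where
  "erf u = 2 / sqrt pi * (LBINT t=0..u. exp (- t\<^sup>2))"

definition limit_objective :: "real \<Rightarrow> real" where
  "limit_objective z = z / 2 * (1 - erf (z / sqrt 2))"

definition z_star :: real where
  "z_star = (THE z. is_arg_max limit_objective (\<lambda>z. z > 0) z)"

definition c_infty :: real where
  "c_infty = (GREATEST c. c \<in> limit_objective ` {0<..})"

definition C_coef :: "nat \<Rightarrow> real" where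
  "C_coef i = sqrt (pi * (real i + 1 / 2)) / 2 ^ (2 * i) * real ((2 * i) choose i)"

definition B0 :: "nat \<Rightarrow> nat \<Rightarrow> real" where
  "B0 m d =
     (SUP b\<in>{0..1}. b * measure_pmf.expectation (binomial_pmf m (1 / real d)) (\<lambda>N. bayes N b))"

definition B1 :: "real \<Rightarrow> real" where
  "B1 \<nu> = (SUP b\<in>{0<..<1}. b * bayes_interp \<nu> b)"

definition B2 :: "real \<Rightarrow> real" where
  "B2 \<nu> = 1 / sqrt \<nu> * (z_star / 2)
     * (1 - C_coef (i_idx \<nu>) * (erf (z_star / sqrt 2) / exp (- z_star\<^sup>2 / (6 * \<nu>))))"

definition B2_tilde :: "real \<Rightarrow> real" where
  "B2_tilde \<nu> = 1 / sqrt \<nu> * (z_star / 2)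
     * (1 - ((real (i_idx \<nu>) + 1) / real (i_idx \<nu>)) powr (1 / 8)
            * (erf (z_star / sqrt 2) / exp (- z_star\<^sup>2 / (6 * \<nu>))))"

text \<open>
  The pairs \<open>(m, d)\<close> vary in an arbitrary way subject only to \<open>m / d \<rightarrow> \<infinity>\<close>.  Pairs with
  \<open>d = 0\<close> are eventually excluded, because \<open>m / 0 = 0\<close>.
\<close>

definition ratio_at_top :: "(nat \<times> nat) filter" where
  "ratio_at_top = filtercomap (\<lambda>(m, d). real m / real d) at_top"

end

(*
  The excess risk of a hypothesis is a sum over the points x of the domain, and what a sample says
  about the label of x is the sum of its labels at x: a biased walk with a binomial number of steps.

  The expected sign of the walk with bias b grows by b P(V = 0) at every step from an even time and
  does not change at the other steps. So s_k(b) is b times the sum of binomial(2j, j) / 4^j (1 - b^2)^j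
  over j < ceiling(k / 2), and its derivative in b is a constant multiple of a power of 1 - b^2.
  Comparison with the Gaussian derivative bounds it by erf from both sides; C_i is the ratio of the
  two normalizing constants and tends to 1 by Wallis's product.

  For the lower bounds, average the risk over all sign patterns of the bias; use Jensen's inequality
  with a line through two consecutive odd points, which lies below the Bayes error because the
  increments of s_k decrease in k; and use that x |-> erf (c sqrt x) is concave.

  For the upper bound, take majority votes: b P(error) is at most (c_infty + o(1)) / sqrt N for N
  relevant examples, uniformly in b, because b / 2 (1 - erf (b sqrt (N / 2))) is equal to
  limit_objective (b sqrt N) / sqrt N. Chebyshev's inequality replaces N by m p_x, and Cauchy-Schwarz
  bounds the sum of sqrt p_x by sqrt d.
*)

theory Submission
  imports Defs
begin

section \<open>The error function and the limiting objective\<close>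

text \<open>The worst bias is of order 1 / sqrt N, so a central limit theorem at a fixed
  \<open>b\<close> would not help: every estimate has to be uniform in \<open>b\<close>. The factor
  \<open>b\<close> in front makes this possible. For small \<open>b\<close> a tie has probability of
  order 1 / sqrt n, but \<open>b\<close> times it is only O(1 / n), so the rule by which the
  majority vote breaks ties affects lower order terms only.

  Parity is the obstacle to Jensen's inequality. Since s_k stays constant from an odd k to the next
  even one, \<open>bayes\<close> is not convex in k; it is convex along the odd k, and this is why
  the interpolation skips the even points. A linear minorant in N has an expectation that depends on
  the mean m / d alone.

  A randomized algorithm may have a different bad sign pattern for every value of its seed. The
  average over all patterns avoids the choice, because it commutes with the integral over the seed.

  The asymptotic estimate says nothing about points with m p_x below a constant K. Such a point
  costs at most K / m, hence all of them at most K / \<nu>, which is negligible against 1 / sqrt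
  \<nu>.\<close>

lemma erf_has_real_derivative [derivative_intros]:
  assumes "(f has_real_derivative f') (at x within A)"
  shows "((\<lambda>x. erf (f x)) has_real_derivative 2 / sqrt pi * exp (- (f x)\<^sup>2) * f') (at x within A)"
proof -
  have "(erf has_real_derivative 2 / sqrt pi * exp (- u\<^sup>2)) (at u)" for u :: real
  proof -
    \<comment> \<open>The interval contains 0 and has \<open>u\<close> in its interior, so the
      derivative within it is a two-sided one.\<close>
    let ?l = "min u 0 - 1" and ?r = "max u 0 + 1"
    have "((\<lambda>u. LBINT t=ereal 0..ereal u. exp (- t\<^sup>2)) has_vector_derivative exp (- u\<^sup>2))
        (at u within {?l..?r})"
      by (rule interval_integral_FTC2) (auto intro!: continuous_intros)
    then have "((\<lambda>u. LBINT t=ereal 0..ereal u. exp (- t\<^sup>2)) has_real_derivative exp (- u\<^sup>2)) (at u)"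
      by (subst (asm) at_within_interior)
        (auto simp: has_real_derivative_iff_has_vector_derivative interior_cbox)
    then have "((\<lambda>u. 2 / sqrt pi * (LBINT t=ereal 0..ereal u. exp (- t\<^sup>2)))
        has_real_derivative 2 / sqrt pi * exp (- u\<^sup>2)) (at u)"
      by (rule DERIV_cmult)
    moreover have "erf = (\<lambda>u. 2 / sqrt pi * (LBINT t=ereal 0..ereal u. exp (- t\<^sup>2)))"
      by (simp add: fun_eq_iff erf_def zero_ereal_def)
    ultimately show ?thesis by simp
  qed
  from DERIV_chain2[OF this assms] show ?thesis .
qed

lemma erf_0 [simp]: "erf 0 = 0"
  by (simp add: erf_def flip: zero_ereal_def)

lemma tendsto_erf_at_top: "(erf \<longlongrightarrow> 1) at_top"
proof -
  have hb: "has_bochner_integral lborel (\<lambda>x. indicator {0..} x *\<^sub>R exp (- x\<^sup>2)) (sqrt pi / 2)"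
    by (rule gaussian_moment_0)
  have int: "integrable lborel (\<lambda>x::real. indicator {0..} x *\<^sub>R exp (- x\<^sup>2))"
    using hb by (auto simp: has_bochner_integral_iff)
  from tendsto_integral_at_top[OF sets_lborel int] have lim: "((\<lambda>u. 2 / sqrt pi * (\<integral>x. indicator {..u} x *\<^sub>R (indicator {0..} x *\<^sub>R exp (- x\<^sup>2)) \<partial>lborel))
      \<longlongrightarrow> 2 / sqrt pi * (sqrt pi / 2)) at_top"
    unfolding has_bochner_integral_integral_eq[OF hb] by (intro tendsto_intros)
  have "\<forall>\<^sub>F u in at_top. 2 / sqrt pi * (\<integral>x. indicator {..u} x *\<^sub>R (indicator {0..} x *\<^sub>R exp (- x\<^sup>2)) \<partial>lborel) = erf u"
    using eventually_ge_at_top[of 0]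
  proof eventually_elim
    case (elim u)
    have "erf u = 2 / sqrt pi * (LBINT t=ereal 0..ereal u. exp (- t\<^sup>2))"
      by (simp add: erf_def zero_ereal_def)
    also have "(LBINT t=ereal 0..ereal u. exp (- t\<^sup>2)) = (LBINT t:{0..u}. exp (- t\<^sup>2))"
      using elim by (rule interval_integral_Icc)
    also have "\<dots> = (\<integral>x. indicator {..u} x *\<^sub>R (indicator {0..} x *\<^sub>R exp (- x\<^sup>2)) \<partial>lborel)"
      unfolding set_lebesgue_integral_def
      by (intro Bochner_Integration.integral_cong) (auto simp: indicator_def)
    finally show ?case by simp
  qed
  from Lim_transform_eventually[OF lim this] show ?thesis by simp
qed

lemma erf_strict_mono: "x < y \<Longrightarrow> erf x < erf y"
  by (rule DERIV_pos_imp_increasing) (auto intro!: exI derivative_eq_intros)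

lemma erf_mono: "x \<le> y \<Longrightarrow> erf x \<le> erf y"
  using erf_strict_mono[of x y] by (cases "x = y") auto

lemma erf_less_1: "erf x < 1"
proof -
  have "erf (x + 1) \<le> 1"
    by (intro tendsto_lowerbound[OF tendsto_erf_at_top] eventually_mono[OF eventually_ge_at_top[of "x + 1"]])
      (auto intro: erf_mono)
  with erf_strict_mono[of x "x + 1"] show ?thesis by simp
qed

lemma erf_nonneg: "0 \<le> x \<Longrightarrow> 0 \<le> erf x"
  using erf_mono[of 0 x] by simp

lemma erf_pos: "0 < x \<Longrightarrow> 0 < erf x"
  using erf_strict_mono[of 0 x] by simp

text \<open>The difference of the two sides has derivative - exp (- t^2) / (t^2 sqrt pi) < 0 and
  tends to 0 at infinity, so it is positive. Strictness comes from one further unit of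
  decrease.\<close>

lemma erfc_less_mills:
  assumes "0 < x"
  shows "1 - erf x < exp (- x\<^sup>2) / (x * sqrt pi)"
proof -
  define g where "g u = exp (- u\<^sup>2) / (u * sqrt pi) - (1 - erf u)" for u
  have anti: "g v < g u" if "0 < u" "u < v" for u v
  proof (rule DERIV_neg_imp_decreasing[OF that(2)])
    fix t assume "u \<le> t" "t \<le> v"
    with that have t: "0 < t" by simp
    have "(g has_real_derivative (exp (- t\<^sup>2) * (- (2 * t)) * (t * sqrt pi) - exp (- t\<^sup>2) * sqrt pi)
        / ((t * sqrt pi) * (t * sqrt pi)) + 2 / sqrt pi * exp (- t\<^sup>2)) (at t)"
      unfolding g_def using t by (auto intro!: derivative_eq_intros)
    also have "(exp (- t\<^sup>2) * (- (2 * t)) * (t * sqrt pi) - exp (- t\<^sup>2) * sqrt pi)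
        / ((t * sqrt pi) * (t * sqrt pi)) + 2 / sqrt pi * exp (- t\<^sup>2) = - exp (- t\<^sup>2) / (t\<^sup>2 * sqrt pi)"
    proof -
      have "(A * (- (2 * t)) * (t * s) - A * s) / ((t * s) * (t * s)) + 2 / s * A = - A / (t\<^sup>2 * s)"
        if "0 < s" for A s :: real
        using t that by (simp add: field_simps power2_eq_square)
      then show ?thesis by simp
    qed
    finally show "\<exists>y. (g has_real_derivative y) (at t) \<and> y < 0"
      using t by (intro exI conjI) (auto simp: field_simps)
  qed
  have lim: "(g \<longlongrightarrow> 0 - (1 - 1)) at_top"
    unfolding g_def
  proof (intro tendsto_intros tendsto_erf_at_top)
    show "((\<lambda>u. exp (- u\<^sup>2) / (u * sqrt pi)) \<longlongrightarrow> 0) at_top"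
    proof (rule tendsto_sandwich)
      show "\<forall>\<^sub>F u in at_top. 0 \<le> exp (- u\<^sup>2) / (u * sqrt pi)"
        using eventually_gt_at_top[of 0] by eventually_elim simp
      show "\<forall>\<^sub>F u in at_top. exp (- u\<^sup>2) / (u * sqrt pi) \<le> inverse u"
        using eventually_gt_at_top[of 0]
      proof eventually_elim
        case (elim u)
        have "exp (- u\<^sup>2) \<le> 1" "1 \<le> sqrt pi" using pi_ge_two by auto
        then have "exp (- u\<^sup>2) / sqrt pi \<le> 1 / 1" by (intro frac_le) auto
        with elim show ?case by (simp add: field_simps)
      qed
    qed (auto intro: tendsto_inverse_0_at_top filterlim_ident)
  qed
  have "0 \<le> g (x + 1)"
  proof (rule tendsto_upperbound[OF lim[simplified]])
    show "\<forall>\<^sub>F u in at_top. g u \<le> g (x + 1)"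
      using eventually_gt_at_top[of "x + 1"]
      by eventually_elim (use anti[of "x + 1"] assms in force)
  qed simp
  with anti[of x "x + 1"] assms show ?thesis by (simp add: g_def)
qed

section \<open>The maximizer of the limiting objective\<close>

lemma erf_scaled_has_derivative:
  "((\<lambda>z. erf (z / sqrt 2)) has_real_derivative sqrt (2 / pi) * exp (- z\<^sup>2 / 2)) (at z within A)"
proof -
  have "((\<lambda>z. erf (z / sqrt 2)) has_real_derivative 2 / sqrt pi * exp (- (z / sqrt 2)\<^sup>2) * (1 / sqrt 2)) (at z within A)"
    by (intro derivative_intros DERIV_cdivide DERIV_ident)
  also have "2 / sqrt pi * exp (- (z / sqrt 2)\<^sup>2) * (1 / sqrt 2) = (2 / sqrt 2) / sqrt pi * exp (- z\<^sup>2 / 2)"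
    by (simp add: power_divide)
  also have "\<dots> = sqrt (2 / pi) * exp (- z\<^sup>2 / 2)"
    by (simp add: real_div_sqrt real_sqrt_divide)
  finally show ?thesis .
qed

text \<open>The derivative of \<open>limit_objective\<close>. Its own derivative is negative only
  below sqrt 2, so monotonicity settles the sign on \<open>{0..1}\<close> and Mills' bound settles
  it beyond 1.\<close>

definition gauss_slope :: "real \<Rightarrow> real" where
  "gauss_slope z = (1 - erf (z / sqrt 2)) / 2 - z / 2 * (sqrt (2 / pi) * exp (- z\<^sup>2 / 2))"

lemma limit_objective_has_derivative:
  "(limit_objective has_real_derivative gauss_slope z) (at z within A)"
  unfolding limit_objective_def[abs_def] gauss_slope_def
  by (rule derivative_eq_intros erf_scaled_has_derivative refl | simp)+

lemma gauss_slope_has_derivative: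
  "(gauss_slope has_real_derivative (z\<^sup>2 - 2) / 2 * (sqrt (2 / pi) * exp (- z\<^sup>2 / 2))) (at z within A)"
proof -
  let ?e = "exp (- z\<^sup>2 / 2)"
  have e: "((\<lambda>z. exp (- z\<^sup>2 / 2)) has_real_derivative - z * ?e) (at z within A)"
    by (rule derivative_eq_intros refl | simp)+
  have "(gauss_slope has_real_derivative (0 - sqrt (2 / pi) * ?e) / 2
      - (1 / 2 * (sqrt (2 / pi) * ?e) + sqrt (2 / pi) * (- z * ?e) * (z / 2))) (at z within A)"
    unfolding gauss_slope_def[abs_def]
    by (intro DERIV_diff DERIV_mult DERIV_cdivide DERIV_const DERIV_ident DERIV_cmult e
        erf_scaled_has_derivative)
  also have "(0 - sqrt (2 / pi) * ?e) / 2 - (1 / 2 * (sqrt (2 / pi) * ?e) + sqrt (2 / pi) * (- z * ?e) * (z / 2))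
      = (z\<^sup>2 - 2) / 2 * (sqrt (2 / pi) * ?e)"
    by (simp add: power2_eq_square field_simps)
  finally show ?thesis .
qed

lemma gauss_slope_strict_antimono:
  assumes "0 \<le> x" "x < y" "y \<le> 1"
  shows "gauss_slope y < gauss_slope x"
proof (rule DERIV_neg_imp_decreasing[OF assms(2)])
  fix t assume t: "x \<le> t" "t \<le> y"
  have "t\<^sup>2 \<le> 1" using t assms by (simp add: power_le_one)
  then have "(t\<^sup>2 - 2) / 2 * (sqrt (2 / pi) * exp (- t\<^sup>2 / 2)) < 0"
    by (intro mult_neg_pos) auto
  then show "\<exists>u. (gauss_slope has_real_derivative u) (at t) \<and> u < 0"
    using gauss_slope_has_derivative by blast
qed

text \<open>The claim compares 1 - erf (z / sqrt 2) with z times the scaled density, while Mills'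
  bound has the factor 1 / z, which is no larger once \<open>1 \<le> z\<close>.\<close>

lemma gauss_slope_neg:
  assumes "1 \<le> z"
  shows "gauss_slope z < 0"
proof -
  have "1 - erf (z / sqrt 2) < exp (- (z / sqrt 2)\<^sup>2) / (z / sqrt 2 * sqrt pi)"
    using assms by (intro erfc_less_mills) simp
  also have "\<dots> = inverse z * (sqrt (2 / pi) * exp (- z\<^sup>2 / 2))"
    using assms by (simp add: power_divide real_sqrt_divide field_simps)
  also have "\<dots> \<le> z * (sqrt (2 / pi) * exp (- z\<^sup>2 / 2))"
    using assms by (intro mult_right_mono) (auto intro: order_trans[of _ 1] simp: inverse_le_1_iff)
  finally show ?thesis by (simp add: gauss_slope_def)
qed

lemma gauss_slope_root: "\<exists>z. 0 < z \<and> z < 1 \<and> gauss_slope z = 0"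
proof -
  have "continuous_on {0..1} gauss_slope"
    by (rule DERIV_continuous_on[OF gauss_slope_has_derivative])
  moreover have "gauss_slope 1 \<le> 0" "0 \<le> gauss_slope 0"
    using gauss_slope_neg[of 1] by (auto simp: gauss_slope_def)
  ultimately obtain z where z: "0 \<le> z" "z \<le> 1" "gauss_slope z = 0"
    using IVT2'[of gauss_slope 1 0 0] by auto
  moreover have "z \<noteq> 0" using z by (auto simp: gauss_slope_def)
  moreover have "z \<noteq> 1" using z gauss_slope_neg[of 1] by auto
  ultimately show ?thesis by (intro exI[of _ z]) auto
qed

lemma limit_objective_unimodal:
  assumes z: "0 < z" "z < 1" "gauss_slope z = 0" and x: "0 < x" "x \<noteq> z"
  shows "limit_objective x < limit_objective z"
proof (cases "x < z")
  case True
  show ?thesis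
  proof (rule DERIV_pos_imp_increasing_open[OF True])
    fix t assume t: "x < t" "t < z"
    with gauss_slope_strict_antimono[of t z] z x
    show "\<exists>y. (limit_objective has_real_derivative y) (at t) \<and> 0 < y"
      using limit_objective_has_derivative by (intro exI[of _ "gauss_slope t"]) auto
  qed (intro DERIV_continuous_on[OF limit_objective_has_derivative])
next
  case False
  with x have zx: "z < x" by simp
  show ?thesis
  proof (rule DERIV_neg_imp_decreasing_open[OF zx])
    fix t assume t: "z < t" "t < x"
    have "gauss_slope t < 0"
      using gauss_slope_strict_antimono[of z t] gauss_slope_neg[of t] z t by (cases "t \<le> 1") auto
    then show "\<exists>y. (limit_objective has_real_derivative y) (at t) \<and> y < 0"
      using limit_objective_has_derivative by (intro exI[of _ "gauss_slope t"]) auto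
  qed (intro DERIV_continuous_on[OF limit_objective_has_derivative])
qed

lemma
  shows z_star_pos: "0 < z_star" and z_star_less_1: "z_star < 1"
    and gauss_slope_z_star: "gauss_slope z_star = 0"
proof -
  obtain z where z: "0 < z" "z < 1" "gauss_slope z = 0"
    using gauss_slope_root by auto
  note uni = limit_objective_unimodal[OF z]
  have "z_star = z"
    unfolding z_star_def is_arg_max_def
  proof (rule the_equality)
    show "0 < z \<and> (\<nexists>y. 0 < y \<and> limit_objective z < limit_objective y)"
      using z uni by (metis less_asym less_irrefl)
    show "y = z" if "0 < y \<and> (\<nexists>w. 0 < w \<and> limit_objective y < limit_objective w)" for y
      using that uni[of y] z(1) by blast
  qed
  with z show "0 < z_star" "z_star < 1" "gauss_slope z_star = 0" by simp_all
qed

lemma limit_objective_le_z_star: "0 < x \<Longrightarrow> limit_objective x \<le> limit_objective z_star"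
  using limit_objective_unimodal[OF z_star_pos z_star_less_1 gauss_slope_z_star, of x]
  by (cases "x = z_star") auto

lemma c_infty_eq: "c_infty = limit_objective z_star"
  unfolding c_infty_def
  by (rule Greatest_equality) (use z_star_pos limit_objective_le_z_star in auto)

lemma limit_objective_le_c_infty: "0 \<le> x \<Longrightarrow> limit_objective x \<le> c_infty"
proof (cases "x = 0")
  case True
  have "0 \<le> limit_objective z_star"
    using z_star_pos erf_less_1[of "z_star / sqrt 2"] by (simp add: limit_objective_def)
  with True show ?thesis by (simp add: c_infty_eq limit_objective_def)
qed (auto simp: c_infty_eq intro: limit_objective_le_z_star)

lemma c_infty_pos: "0 < c_infty"
  using z_star_pos erf_less_1[of "z_star / sqrt 2"] by (simp add: c_infty_eq limit_objective_def)

section \<open>Taylor bounds and the numerical value of the maximum\<close>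

lemma exp_Taylor_even_le:
  fixes x :: real
  assumes "even n"
  shows "(\<Sum>m<n. x ^ m / fact m) \<le> exp x"
proof -
  obtain t where "exp x = (\<Sum>m<n. x ^ m / fact m) + exp t / fact n * x ^ n"
    using Maclaurin_exp_le[of x n] by blast
  with assms show ?thesis by (simp add: zero_le_even_power)
qed

lemma exp_le_Taylor_odd:
  fixes x :: real
  assumes "odd n" "x \<le> 0"
  shows "exp x \<le> (\<Sum>m<n. x ^ m / fact m)"
proof -
  obtain t where "exp x = (\<Sum>m<n. x ^ m / fact m) + exp t / fact n * x ^ n"
    using Maclaurin_exp_le[of x n] by blast
  moreover have "exp t / fact n * x ^ n \<le> 0"
    using assms by (intro mult_nonneg_nonpos) (auto simp: power_le_zero_eq odd_pos)
  ultimately show ?thesis by simp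
qed

text \<open>The integral from 0 to z of the first \<open>n\<close> Taylor terms of exp (- t^2 / 2).
  The series alternates, so even \<open>n\<close> gives lower bounds and odd \<open>n\<close> upper
  bounds of a multiple of erf.\<close>

definition gauss_poly :: "nat \<Rightarrow> real \<Rightarrow> real" where
  "gauss_poly n z = (\<Sum>m<n. (-1) ^ m * z ^ (2 * m + 1) / (2 ^ m * fact m * real (2 * m + 1)))"

lemma gauss_poly_has_derivative:
  "(gauss_poly n has_real_derivative (\<Sum>m<n. (- z\<^sup>2 / 2) ^ m / fact m)) (at z within A)"
proof -
  have *: "((\<lambda>z. (-1) ^ m * z ^ (2 * m + 1) / (2 ^ m * fact m * real (2 * m + 1)))
      has_real_derivative (- z\<^sup>2 / 2) ^ m / fact m) (at z within A)" for m
  proof -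
    have "((\<lambda>z. (-1) ^ m * z ^ (2 * m + 1) / (2 ^ m * fact m * real (2 * m + 1)))
      has_real_derivative (-1) ^ m * (real (2 * m + 1) * z ^ (2 * m)) / (2 ^ m * fact m * real (2 * m + 1))) (at z within A)"
      by (rule derivative_eq_intros refl | simp)+
    also have "(-1) ^ m * (real (2 * m + 1) * z ^ (2 * m)) / (2 ^ m * fact m * real (2 * m + 1))
        = ((-1) ^ m * z ^ (2 * m) / (2 ^ m * fact m)) * (real (2 * m + 1) / real (2 * m + 1))"
      by (simp only: times_divide_eq_left times_divide_eq_right divide_divide_eq_left mult_ac)
    also have "\<dots> = (- z\<^sup>2 / 2) ^ m / fact m"
      by (simp add: power_minus' power_divide power_mult power_minus[of "z\<^sup>2"])
    finally show ?thesis .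
  qed
  show ?thesis
    unfolding gauss_poly_def[abs_def] by (intro DERIV_sum *)
qed

lemma gauss_poly_le_erf:
  assumes "even n" "0 \<le> z"
  shows "sqrt (2 / pi) * gauss_poly n z \<le> erf (z / sqrt 2)"
proof -
  let ?f = "\<lambda>z. erf (z / sqrt 2) - sqrt (2 / pi) * gauss_poly n z"
  have "?f 0 \<le> ?f z"
  proof (rule DERIV_nonneg_imp_nondecreasing[OF assms(2)], intro exI conjI)
    fix x :: real
    show "(?f has_real_derivative sqrt (2 / pi) * exp (- x\<^sup>2 / 2)
        - sqrt (2 / pi) * (\<Sum>m<n. (- x\<^sup>2 / 2) ^ m / fact m)) (at x)"
      by (intro DERIV_diff erf_scaled_has_derivative DERIV_cmult gauss_poly_has_derivative)
    show "0 \<le> sqrt (2 / pi) * exp (- x\<^sup>2 / 2) - sqrt (2 / pi) * (\<Sum>m<n. (- x\<^sup>2 / 2) ^ m / fact m)"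
      using exp_Taylor_even_le[OF assms(1), of "- x\<^sup>2 / 2"] by (simp add: mult_left_mono)
  qed
  then show ?thesis by (simp add: gauss_poly_def)
qed

lemma erf_le_gauss_poly:
  assumes "odd n" "0 \<le> z"
  shows "erf (z / sqrt 2) \<le> sqrt (2 / pi) * gauss_poly n z"
proof -
  let ?f = "\<lambda>z. sqrt (2 / pi) * gauss_poly n z - erf (z / sqrt 2)"
  have "?f 0 \<le> ?f z"
  proof (rule DERIV_nonneg_imp_nondecreasing[OF assms(2)], intro exI conjI)
    fix x :: real
    show "(?f has_real_derivative sqrt (2 / pi) * (\<Sum>m<n. (- x\<^sup>2 / 2) ^ m / fact m)
        - sqrt (2 / pi) * exp (- x\<^sup>2 / 2)) (at x)"
      by (intro DERIV_diff erf_scaled_has_derivative DERIV_cmult gauss_poly_has_derivative)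
    show "0 \<le> sqrt (2 / pi) * (\<Sum>m<n. (- x\<^sup>2 / 2) ^ m / fact m) - sqrt (2 / pi) * exp (- x\<^sup>2 / 2)"
      using exp_le_Taylor_odd[OF assms(1), of "- x\<^sup>2 / 2"] by (simp add: mult_left_mono)
  qed
  then show ?thesis by (simp add: gauss_poly_def)
qed

lemma Taylor_7: "(\<Sum>m<7. x ^ m / fact m) = 1 + x + x^2/2 + x^3/6 + x^4/24 + x^5/120 + x^6/720" for x :: real
  by (simp add: lessThan_nat_numeral fact_numeral)

lemma Taylor_8: "(\<Sum>m<8. x ^ m / fact m) = 1 + x + x^2/2 + x^3/6 + x^4/24 + x^5/120 + x^6/720 + x^7/5040" for x :: real
  by (simp add: lessThan_nat_numeral fact_numeral)

lemma gauss_poly_7: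
  "gauss_poly 7 z = z - z^3/6 + z^5/40 - z^7/336 + z^9/3456 - z^11/42240 + z^13/599040"
  by (simp add: gauss_poly_def lessThan_nat_numeral fact_numeral flip: power_Suc)

lemma gauss_poly_8: "gauss_poly 8 z = gauss_poly 7 z - z^15/9676800"
  by (simp add: gauss_poly_def lessThan_nat_numeral fact_numeral flip: power_Suc)

lemma sqrt_2_div_pi_bounds: "0.7978845 \<le> sqrt (2 / pi)" "sqrt (2 / pi) \<le> 0.7978846"
proof -
  note pi = pi_approx
  have "2 / 3.1415926535899 \<le> 2 / pi" "2 / pi \<le> 2 / 3.141592653588"
    using pi by (intro divide_left_mono; simp)+
  then show "0.7978845 \<le> sqrt (2 / pi)" "sqrt (2 / pi) \<le> 0.7978846"
    by (intro real_le_rsqrt real_le_lsqrt; simp add: power2_eq_square)+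
qed

text \<open>The maximum is flat, so a single evaluation at 3/4, close to the maximizer 0.7517...,
  already reaches five decimals.\<close>

lemma c_infty_lower: "0.16997 \<le> c_infty"
proof -
  have "erf (3 / 4 / sqrt 2) \<le> sqrt (2 / pi) * gauss_poly 7 (3 / 4)"
    by (rule erf_le_gauss_poly) auto
  also have "\<dots> \<le> 0.7978846 * gauss_poly 7 (3 / 4)"
    by (intro mult_right_mono sqrt_2_div_pi_bounds)
      (simp add: gauss_poly_8 gauss_poly_7 Taylor_7 Taylor_8 power_divide)
  also have "\<dots> \<le> 1 - 0.16997 * 8 / 3"
    by (simp add: gauss_poly_8 gauss_poly_7 Taylor_7 Taylor_8 power_divide)
  finally have "0.16997 \<le> limit_objective (3 / 4)"
    by (simp add: limit_objective_def)
  also have "\<dots> \<le> c_infty" by (rule limit_objective_le_c_infty) simp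
  finally show ?thesis .
qed

text \<open>The signs locate \<open>z_star\<close> between 3/4 and 19/25, and the small slope at 3/4
  limits the rise of \<open>limit_objective\<close> from there to its maximum. Seven terms bound erf
  and exp from above, eight bound them from below.\<close>

lemma gauss_slope_bounds: "0 < gauss_slope (3 / 4)" "gauss_slope (3 / 4) < 0.0008" "gauss_slope (19 / 25) < 0"
proof -
  have sq: "0 \<le> sqrt (2 / pi)" by simp
  have lo: "(1 - 0.7978846 * gauss_poly 7 z) / 2
      - z / 2 * (0.7978846 * (\<Sum>m<7. (- z\<^sup>2 / 2) ^ m / fact m)) \<le> gauss_slope z"
    if "0 \<le> z" "0 \<le> gauss_poly 7 z" for z
  proof -
    have "erf (z / sqrt 2) \<le> sqrt (2 / pi) * gauss_poly 7 z"
      by (rule erf_le_gauss_poly) (use that in auto)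
    also have "\<dots> \<le> 0.7978846 * gauss_poly 7 z"
      by (intro mult_right_mono sqrt_2_div_pi_bounds that)
    finally have 1: "erf (z / sqrt 2) \<le> 0.7978846 * gauss_poly 7 z" .
    have "sqrt (2 / pi) * exp (- z\<^sup>2 / 2) \<le> 0.7978846 * (\<Sum>m<7. (- z\<^sup>2 / 2) ^ m / fact m)"
      by (intro mult_mono sqrt_2_div_pi_bounds exp_le_Taylor_odd) auto
    then have "z / 2 * (sqrt (2 / pi) * exp (- z\<^sup>2 / 2)) \<le> z / 2 * (0.7978846 * (\<Sum>m<7. (- z\<^sup>2 / 2) ^ m / fact m))"
      using that by (intro mult_left_mono) auto
    with 1 show ?thesis unfolding gauss_slope_def by (intro diff_mono divide_right_mono) simp_all
  qed
  have up: "gauss_slope z \<le> (1 - 0.7978845 * gauss_poly 8 z) / 2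
      - z / 2 * (0.7978845 * (\<Sum>m<8. (- z\<^sup>2 / 2) ^ m / fact m))"
    if "0 \<le> z" "0 \<le> gauss_poly 8 z" "0 \<le> (\<Sum>m<8. (- z\<^sup>2 / 2) ^ m / fact m)" for z
  proof -
    have "0.7978845 * gauss_poly 8 z \<le> sqrt (2 / pi) * gauss_poly 8 z"
      by (intro mult_right_mono sqrt_2_div_pi_bounds that)
    also have "\<dots> \<le> erf (z / sqrt 2)"
      by (rule gauss_poly_le_erf) (use that in auto)
    finally have 1: "0.7978845 * gauss_poly 8 z \<le> erf (z / sqrt 2)" .
    have "0.7978845 * (\<Sum>m<8. (- z\<^sup>2 / 2) ^ m / fact m) \<le> sqrt (2 / pi) * exp (- z\<^sup>2 / 2)"
      by (intro mult_mono sqrt_2_div_pi_bounds exp_Taylor_even_le that sq) auto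
    then have "z / 2 * (0.7978845 * (\<Sum>m<8. (- z\<^sup>2 / 2) ^ m / fact m)) \<le> z / 2 * (sqrt (2 / pi) * exp (- z\<^sup>2 / 2))"
      using that by (intro mult_left_mono) auto
    with 1 show ?thesis unfolding gauss_slope_def by (intro diff_mono divide_right_mono) simp_all
  qed
  note num = gauss_poly_8 gauss_poly_7 Taylor_7 Taylor_8 power_divide
  show "0 < gauss_slope (3 / 4)"
    by (rule less_le_trans[OF _ lo[of "3 / 4"]]) (simp_all add: num)
  show "gauss_slope (3 / 4) < 0.0008"
    by (rule le_less_trans[OF up[of "3 / 4"]]) (simp_all add: num)
  show "gauss_slope (19 / 25) < 0"
    by (rule le_less_trans[OF up[of "19 / 25"]]) (simp_all add: num)
qed

lemma c_infty_upper: "c_infty < 0.16998"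
proof -
  have "3 / 4 < z_star"
    using gauss_slope_strict_antimono[of z_star "3 / 4"] gauss_slope_bounds(1) z_star_pos gauss_slope_z_star
    by (cases "z_star = 3 / 4") force+
  moreover have "z_star < 19 / 25"
    using gauss_slope_strict_antimono[of "19 / 25" z_star] gauss_slope_bounds(3) z_star_less_1 gauss_slope_z_star
    by (cases "z_star = 19 / 25") force+
  moreover obtain \<xi> where \<xi>: "3 / 4 < \<xi>" "\<xi> < z_star"
      "limit_objective z_star - limit_objective (3 / 4) = (z_star - 3 / 4) * gauss_slope \<xi>"
    using MVT2[OF \<open>3 / 4 < z_star\<close>, of limit_objective gauss_slope] limit_objective_has_derivative by blast
  moreover have "gauss_slope \<xi> < 0.0008"
    using gauss_slope_strict_antimono[of "3 / 4" \<xi>] \<xi> z_star_less_1 gauss_slope_bounds(2) by auto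
  \<comment> \<open>The distance is below 0.76 - 0.75 and the slope decreases from a value below
    0.0008. The rise is thus at most 0.000008, and 0.169971 + 0.000008 is still below
    0.16998.\<close>
  ultimately have "limit_objective z_star - limit_objective (3 / 4) \<le> 0.01 * 0.0008"
    using gauss_slope_strict_antimono[of \<xi> z_star] gauss_slope_z_star z_star_less_1
    unfolding \<xi>(3) by (intro mult_mono) auto
  moreover have "limit_objective (3 / 4) < 0.169971"
  proof -
    have "1 - 0.169971 * 8 / 3 < 0.7978845 * gauss_poly 8 (3 / 4)"
      by (simp add: gauss_poly_8 gauss_poly_7 Taylor_7 Taylor_8 power_divide)
    also have "\<dots> \<le> sqrt (2 / pi) * gauss_poly 8 (3 / 4)"
      by (intro mult_right_mono sqrt_2_div_pi_bounds)
        (simp add: gauss_poly_8 gauss_poly_7 Taylor_7 Taylor_8 power_divide)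
    also have "\<dots> \<le> erf (3 / 4 / sqrt 2)"
      by (rule gauss_poly_le_erf) auto
    finally show ?thesis by (simp add: limit_objective_def)
  qed
  ultimately show ?thesis by (simp add: c_infty_eq)
qed

section \<open>Central binomial coefficients\<close>

text \<open>The probability that a fair walk is at 0 after \<open>2 * i\<close> steps.\<close>

definition central :: "nat \<Rightarrow> real" where
  "central i = real ((2 * i) choose i) / 4 ^ i"

lemma central_0 [simp]: "central 0 = 1"
  by (simp add: central_def)

lemma central_pos: "0 < central i"
  by (simp add: central_def)

lemma central_Suc: "(2 * real i + 2) * central (Suc i) = (2 * real i + 1) * central i"
proof -
  have 1: "Suc i * ((2 * i + 2) choose (Suc i)) = (2 * i + 2) * ((2 * i + 1) choose i)"
    using Suc_times_binomial_eq[of "2 * i + 1" i] by simp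
  have 2: "Suc i * ((2 * i + 1) choose i) = (2 * i + 1) * ((2 * i) choose i)"
    using binomial_absorb_comp[of "2 * i + 1" i] by (simp add: Suc_diff_le)
  have "Suc i * (Suc i * ((2 * i + 2) choose (Suc i))) = (2 * i + 2) * (Suc i * ((2 * i + 1) choose i))"
    unfolding 1 by (rule mult.left_commute)
  also have "\<dots> = Suc i * (2 * ((2 * i + 1) * ((2 * i) choose i)))"
    unfolding 2 by (simp only: mult_Suc_right mult_ac) (simp only: algebra_simps mult_Suc)
  finally have "Suc i * ((2 * i + 2) choose (Suc i)) = 2 * ((2 * i + 1) * ((2 * i) choose i))"
    by (rule mult_left_cancel[THEN iffD1, rotated]) simp
  then have "real (Suc i) * real ((2 * i + 2) choose (Suc i)) = 2 * (real (2 * i + 1) * real ((2 * i) choose i))"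
    by (metis of_nat_mult of_nat_numeral)
  moreover define B where "B = real ((2 * i + 2) choose (Suc i))"
  moreover have "central (Suc i) = B / (4 * 4 ^ i)"
    by (simp add: central_def B_def)
  ultimately have "real (Suc i) * (4 * 4 ^ i * central (Suc i)) = 2 * (real (2 * i + 1) * (4 ^ i * central i))"
    by (simp add: central_def)
  then have "2 * 4 ^ i * ((2 * real i + 2) * central (Suc i)) = 2 * 4 ^ i * ((2 * real i + 1) * central i)"
    by (simp add: algebra_simps)
  then show ?thesis by (rule mult_left_cancel[THEN iffD1, rotated]) simp
qed

lemma central_antimono: "central (Suc i) \<le> central i"
proof -
  have "(2 * real i + 2) * central (Suc i) \<le> (2 * real i + 2) * central i"
    using central_Suc[of i] central_pos[of i] by (simp add: algebra_simps)
  then show ?thesis by (simp add: mult_le_cancel_left)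
qed

lemma C_coef_eq: "C_coef i = sqrt (pi * (real i + 1 / 2)) * central i"
  by (simp add: C_coef_def central_def power_mult)

lemma C_coef_pos: "0 < C_coef i"
  by (simp add: C_coef_eq central_pos add_nonneg_pos)

text \<open>The left side is the slope of \<open>gap_poly (Suc i)\<close> at 0; on the right, the
  factors next to \<open>C_coef i\<close> form the slope at 0 of b |-> erf (b sqrt (i +
  1/2)).\<close>

lemma C_coef_central: "(2 * real i + 1) * central i = C_coef i * (2 / sqrt pi) * sqrt (real i + 1 / 2)"
proof -
  have "C_coef i * (2 / sqrt pi) * sqrt (real i + 1 / 2)
      = central i * 2 * (sqrt (real i + 1 / 2) * sqrt (real i + 1 / 2)) * (sqrt pi / sqrt pi)"
    unfolding C_coef_eq real_sqrt_mult by (simp only: times_divide_eq_left times_divide_eq_right mult_ac)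
  also have "sqrt (real i + 1 / 2) * sqrt (real i + 1 / 2) = real i + 1 / 2"
    by (rule real_sqrt_mult_self[THEN trans]) simp
  finally show ?thesis by (simp add: algebra_simps)
qed

lemma C_coef_sq_Suc:
  "(C_coef (Suc i))\<^sup>2 = (C_coef i)\<^sup>2 * (1 - 1 / (2 * real i + 2)\<^sup>2)"
proof -
  have sq: "(C_coef j)\<^sup>2 = pi * (real j + 1 / 2) * (central j)\<^sup>2" for j
    by (simp add: C_coef_eq power_mult_distrib)
  have c: "central (Suc i) = (2 * real i + 1) / (2 * real i + 2) * central i"
    using central_Suc[of i] by (simp add: field_simps)
  show ?thesis
    unfolding sq c by (simp add: power_mult_distrib divide_simps) (simp add: power2_eq_square algebra_simps)
qed

lemma C_coef_Suc_le: "C_coef (Suc i) \<le> C_coef i"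
proof (rule power2_le_imp_le)
  show "(C_coef (Suc i))\<^sup>2 \<le> (C_coef i)\<^sup>2"
    unfolding C_coef_sq_Suc by (simp add: algebra_simps)
qed (simp add: less_imp_le[OF C_coef_pos])

text \<open>Starting from (C_0)^2 = pi / 2, each step of \<open>C_coef_sq_Suc\<close> divides by one
  factor of Wallis's product.\<close>

lemma C_coef_wallis:
  "(C_coef n)\<^sup>2 = pi / 2 / (\<Prod>k=1..n. (4 * real k ^ 2) / (4 * real k ^ 2 - 1))"
proof (induction n)
  case 0
  show ?case by (simp add: C_coef_eq)
next
  case (Suc n)
  have "1 \<le> (real (Suc n))\<^sup>2" by simp
  then have "0 < 4 * (real (Suc n))\<^sup>2 - 1" by linarith
  moreover have "(2 * real n + 2)\<^sup>2 = 4 * (real (Suc n))\<^sup>2"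
    by (simp add: power2_eq_square algebra_simps)
  ultimately have "1 - 1 / (2 * real n + 2)\<^sup>2 = 1 / (4 * real (Suc n) ^ 2 / (4 * real (Suc n) ^ 2 - 1))"
    by (simp add: field_simps del: of_nat_Suc)
  with Suc show ?case by (simp add: C_coef_sq_Suc prod.nat_ivl_Suc')
qed

lemma tendsto_C_coef: "C_coef \<longlonglongrightarrow> 1"
proof -
  have "(\<lambda>n. pi / 2 / (\<Prod>k=1..n. (4 * real k ^ 2) / (4 * real k ^ 2 - 1))) \<longlonglongrightarrow> pi / 2 / (pi / 2)"
    by (intro tendsto_divide tendsto_const wallis) simp
  then have "(\<lambda>n. (C_coef n)\<^sup>2) \<longlonglongrightarrow> 1"
    by (simp add: C_coef_wallis)
  from tendsto_real_sqrt[OF this] show ?thesis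
    using C_coef_pos by (simp add: less_imp_le)
qed

text \<open>The eighth power of C_i times i / (i + 1) increases to 1. With n = 2 i + 2, passing from
  i to i + 1 multiplies C_i^8 by (1 - 1/n^2)^4, at least 1 - 4/n^2 by Bernoulli's inequality, and
  divides i / (i + 1) by exactly 1 - 4/n^2. This match is the origin of the exponent 1/8.\<close>

lemma C_coef_le_powr:
  assumes "1 \<le> i"
  shows "C_coef i \<le> ((real i + 1) / real i) powr (1 / 8)"
proof -
  define u where "u j = (C_coef (Suc j)) ^ 8 * (real (Suc j) / (real (Suc j) + 1))" for j
  have "u j \<le> u (Suc j)" for j
  proof -
    define n where "n = 2 * real (Suc j) + 2"
    have n: "4 \<le> n" by (simp add: n_def)
    then have n1: "0 \<le> 1 - 1 / n\<^sup>2" "1 / n\<^sup>2 \<le> 1 / 4"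
      using power_mono[of 4 n 2] by (auto simp: divide_simps)
    have C8: "C_coef k ^ 8 = ((C_coef k)\<^sup>2) ^ 4" for k by simp
    have "1 - 4 / n\<^sup>2 \<le> (1 - 1 / n\<^sup>2) ^ 4"
      using Bernoulli_inequality[of "- (1 / n\<^sup>2)" 4] n1 by simp
    moreover have "real (Suc j) / (real (Suc j) + 1)
        = (1 - 4 / n\<^sup>2) * (real (Suc (Suc j)) / (real (Suc (Suc j)) + 1))"
      unfolding n_def by (simp add: divide_simps) (simp add: algebra_simps power2_eq_square)
    ultimately have "C_coef (Suc j) ^ 8 * (real (Suc j) / (real (Suc j) + 1))
        \<le> C_coef (Suc j) ^ 8 * ((1 - 1 / n\<^sup>2) ^ 4 * (real (Suc (Suc j)) / (real (Suc (Suc j)) + 1)))"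
      by (simp only:) (intro mult_left_mono mult_right_mono, auto)
    then show ?thesis
      unfolding u_def C8 C_coef_sq_Suc[of "Suc j"] n_def[symmetric] by (simp add: power_mult_distrib mult_ac)
  qed
  then have "incseq u" by (rule incseq_SucI)
  moreover have "u \<longlonglongrightarrow> 1 ^ 8 * 1"
    unfolding u_def
  proof (rule tendsto_mult)
    show "(\<lambda>j. C_coef (Suc j) ^ 8) \<longlonglongrightarrow> 1 ^ 8"
      by (intro tendsto_power LIMSEQ_Suc tendsto_C_coef)
    show "(\<lambda>j. real (Suc j) / (real (Suc j) + 1)) \<longlonglongrightarrow> 1"
      using LIMSEQ_Suc[OF LIMSEQ_n_over_Suc_n[where 'a = real]] by (simp add: algebra_simps)
  qed
  ultimately have "u (i - 1) \<le> 1" using incseq_le by fastforce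
  with assms have "C_coef i ^ 8 \<le> (real i + 1) / real i"
    by (simp add: u_def field_simps)
  then have "(C_coef i ^ 8) powr (1 / 8) \<le> ((real i + 1) / real i) powr (1 / 8)"
    by (intro powr_mono2) (simp_all)
  also have "(C_coef i ^ 8) powr (1 / 8) = C_coef i"
    using C_coef_pos[of i] by (simp add: powr_powr flip: powr_numeral)
  finally show ?thesis .
qed

section \<open>The polynomial form of s_k and its Gaussian comparison\<close>

definition gap_poly :: "nat \<Rightarrow> real \<Rightarrow> real" where
  "gap_poly n b = b * (\<Sum>j<n. central j * (1 - b\<^sup>2) ^ j)"

lemma gap_poly_0 [simp]: "gap_poly n 0 = 0"
  by (simp add: gap_poly_def)

lemma gap_poly_1 [simp]: "gap_poly (Suc n) 1 = 1"
  unfolding gap_poly_def sum.lessThan_Suc_shift by simp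

text \<open>The recursion of the central coefficients makes the sum telescope to one term. Hence
  \<open>gap_poly (Suc i)\<close> is the integral of (1 - t^2)^i over [0, b], normalized to be 1 at
  \<open>b = 1\<close>.\<close>

lemma gap_poly_has_derivative:
  "(gap_poly (Suc i) has_real_derivative (2 * real i + 1) * central i * (1 - b\<^sup>2) ^ i) (at b within A)"
proof (induction i)
  case 0
  show ?case by (simp add: gap_poly_def)
next
  case (Suc i)
  have eq: "gap_poly (Suc (Suc i)) = (\<lambda>b. gap_poly (Suc i) b + b * (central (Suc i) * (1 - b\<^sup>2) ^ Suc i))"
    by (simp add: gap_poly_def fun_eq_iff algebra_simps)
  have "(gap_poly (Suc (Suc i)) has_real_derivative (2 * real i + 1) * central i * (1 - b\<^sup>2) ^ i
      + (1 * (central (Suc i) * (1 - b\<^sup>2) ^ Suc i)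
         + central (Suc i) * (real (Suc i) * (- (2 * b)) * (1 - b\<^sup>2) ^ i) * b)) (at b within A)"
    unfolding eq
    by (rule DERIV_add[OF Suc] DERIV_mult DERIV_ident derivative_eq_intros refl | simp)+
  also have "(2 * real i + 1) * central i * (1 - b\<^sup>2) ^ i
      + (1 * (central (Suc i) * (1 - b\<^sup>2) ^ Suc i)
         + central (Suc i) * (real (Suc i) * (- (2 * b)) * (1 - b\<^sup>2) ^ i) * b)
      = (2 * real (Suc i) + 1) * central (Suc i) * (1 - b\<^sup>2) ^ Suc i"
    unfolding central_Suc[of i, symmetric] by (simp add: power2_eq_square algebra_simps)
  finally show ?case .
qed

text \<open>The integrand of erf is at least its value at the right end. The bound is needed in
  exactly this form to absorb the factor 1 + x / 3 of the next lemma.\<close>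

lemma erf_ge: 
  assumes "0 \<le> x"
  shows "2 / sqrt pi * x * exp (- x\<^sup>2) \<le> erf x"
proof -
  let ?f = "\<lambda>x. erf x - 2 / sqrt pi * (x * exp (- x\<^sup>2))"
  have "?f 0 \<le> ?f x"
  proof (rule DERIV_nonneg_imp_nondecreasing[OF assms], intro exI conjI)
    fix t :: real
    have "((\<lambda>t. t * exp (- t\<^sup>2)) has_real_derivative (1 - 2 * t\<^sup>2) * exp (- t\<^sup>2)) (at t)"
      by (rule derivative_eq_intros refl | simp)+ (simp add: power2_eq_square algebra_simps)
    then show "(?f has_real_derivative 2 / sqrt pi * exp (- t\<^sup>2) * 1 - 2 / sqrt pi * ((1 - 2 * t\<^sup>2) * exp (- t\<^sup>2))) (at t)"
      by (intro DERIV_diff erf_has_real_derivative DERIV_ident DERIV_cmult)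
    show "0 \<le> 2 / sqrt pi * exp (- t\<^sup>2) * 1 - 2 / sqrt pi * ((1 - 2 * t\<^sup>2) * exp (- t\<^sup>2))"
      by (simp add: field_simps)
  qed
  then show ?thesis by (simp add: mult_ac)
qed

text \<open>The exponent on the right is -(i + 1/3) x. One factor is set aside and bounded by (1 -
  x) exp (4 x / 3) \<le> 1 + x / 3; the other i - 1 factors are at most exp (- x) each, and 4/3 + (i
  - 1) = i + 1/3.\<close>

lemma one_minus_power_le_exp:
  fixes x :: real
  assumes "1 \<le> i" "0 \<le> x" "x \<le> 1"
  shows "(1 - x) ^ i \<le> exp (x / 6 - (real i + 1 / 2) * x) * (1 + x / 3)"
proof -
  let ?f = "\<lambda>x::real. 1 + x / 3 - (1 - x) * exp (4 * x / 3)"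
  have "?f 0 \<le> ?f x"
  proof (rule DERIV_nonneg_imp_nondecreasing[OF assms(2)], intro exI conjI)
    fix t :: real assume t: "0 \<le> t" "t \<le> x"
    show "(?f has_real_derivative (1 - (1 - 4 * t) * exp (4 * t / 3)) / 3) (at t)"
      by (rule derivative_eq_intros refl | simp)+ (simp add: field_simps)
    have "(1 - 4 * t) * exp (4 * t / 3) \<le> 1"
    proof (cases "1 - 4 * t \<le> 0")
      case True
      then have "(1 - 4 * t) * exp (4 * t / 3) \<le> 0" by (simp add: mult_nonpos_nonneg)
      then show ?thesis by simp
    next
      case False
      have "(1 - 4 * t) * exp (4 * t / 3) \<le> exp (- (4 * t)) * exp (4 * t)"
        using False t exp_ge_add_one_self[of "- (4 * t)"] by (intro mult_mono) auto
      then show ?thesis by (simp flip: exp_add)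
    qed
    then show "0 \<le> (1 - (1 - 4 * t) * exp (4 * t / 3)) / 3" by simp
  qed
  then have main: "(1 - x) * exp (4 * x / 3) \<le> 1 + x / 3" by simp
  obtain j where i: "i = Suc j" using assms(1) by (cases i) auto
  have "(1 - x) ^ i = (1 - x) * exp (4 * x / 3) * exp (- (4 * x / 3)) * (1 - x) ^ j"
    by (simp add: i exp_minus)
  also have "\<dots> \<le> (1 + x / 3) * exp (- (4 * x / 3)) * (exp (- x)) ^ j"
    using main assms exp_ge_add_one_self[of "- x"] by (intro mult_mono power_mono) auto
  also have "(1 + x / 3) * exp (- (4 * x / 3)) * (exp (- x)) ^ j = exp (x / 6 - (real i + 1 / 2) * x) * (1 + x / 3)"
    by (simp add: i exp_minus exp_diff exp_add field_simps flip: exp_of_nat_mult exp_add exp_diff)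
  finally show ?thesis .
qed

text \<open>Both sides vanish at 0, so derivatives are compared. The factor exp (b^2 / 6)
  contributes (t / 3) erf (t k), with k = sqrt (i + 1/2), and by \<open>erf_ge\<close> this supplies
  the relative surplus t^2 / 3 that \<open>one_minus_power_le_exp\<close> asks for. It is also where
  the exponent z^2 / (6 \<nu>) of the bounds comes from.\<close>

lemma gap_poly_le_erf:
  assumes "1 \<le> i" "0 \<le> b" "b \<le> 1"
  shows "gap_poly (Suc i) b \<le> C_coef i * (exp (b\<^sup>2 / 6) * erf (b * sqrt (real i + 1 / 2)))"
proof -
  let ?k = "sqrt (real i + 1 / 2)"
  let ?f = "\<lambda>b. C_coef i * (exp (b\<^sup>2 / 6) * erf (b * ?k)) - gap_poly (Suc i) b"
  have "?f 0 \<le> ?f b"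
  proof (rule DERIV_nonneg_imp_nondecreasing[OF assms(2)], intro exI conjI)
    fix t assume t: "0 \<le> t" "t \<le> b"
    let ?e = "2 / sqrt pi * exp (- (t * ?k)\<^sup>2)"
    have 1: "((\<lambda>t. exp (t\<^sup>2 / 6)) has_real_derivative exp (t\<^sup>2 / 6) * (t / 3)) (at t)"
      by (rule derivative_eq_intros refl | simp)+
    have 2: "((\<lambda>t. erf (t * ?k)) has_real_derivative ?e * ?k) (at t)"
      using erf_has_real_derivative[OF DERIV_cmult_right[OF DERIV_ident]] by simp
    show "(?f has_real_derivative C_coef i * (exp (t\<^sup>2 / 6) * (t / 3) * erf (t * ?k) + ?e * ?k * exp (t\<^sup>2 / 6))
        - (2 * real i + 1) * central i * (1 - t\<^sup>2) ^ i) (at t)"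
      by (intro DERIV_diff DERIV_cmult DERIV_mult 1 2 gap_poly_has_derivative)
    have "(2 * real i + 1) * central i * (1 - t\<^sup>2) ^ i
        \<le> (2 * real i + 1) * central i * (exp (t\<^sup>2 / 6 - (real i + 1 / 2) * t\<^sup>2) * (1 + t\<^sup>2 / 3))"
      using t assms central_pos[of i]
      by (intro mult_left_mono one_minus_power_le_exp) (auto simp: power_le_one)
    also have "\<dots> = C_coef i * (exp (t\<^sup>2 / 6) * (t / 3) * (2 / sqrt pi * (t * ?k) * exp (- (t * ?k)\<^sup>2)) + ?e * ?k * exp (t\<^sup>2 / 6))"
    proof -
      have "(t * ?k)\<^sup>2 = (real i + 1 / 2) * t\<^sup>2" by (simp add: power_mult_distrib)
      then have "exp (t\<^sup>2 / 6 - (real i + 1 / 2) * t\<^sup>2) = exp (t\<^sup>2 / 6) * exp (- (t * ?k)\<^sup>2)"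
        by (simp flip: exp_add)
      then show ?thesis
        unfolding C_coef_central by (simp add: power2_eq_square algebra_simps)
    qed
    also have "\<dots> \<le> C_coef i * (exp (t\<^sup>2 / 6) * (t / 3) * erf (t * ?k) + ?e * ?k * exp (t\<^sup>2 / 6))"
      using t C_coef_pos[of i] by (intro mult_left_mono add_right_mono erf_ge) auto
    finally show "0 \<le> C_coef i * (exp (t\<^sup>2 / 6) * (t / 3) * erf (t * ?k) + ?e * ?k * exp (t\<^sup>2 / 6))
        - (2 * real i + 1) * central i * (1 - t\<^sup>2) ^ i" by simp
  qed
  then show ?thesis by simp
qed

text \<open>Here the comparison starts at the right end, where the left side is 0, and uses (1 -
  t^2)^i \<le> exp (- i t^2). The scale sqrt i in place of sqrt (i + 1/2) costs the square root in
  front, which tends to 1.\<close>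

lemma one_minus_gap_poly_le_erfc:
  assumes "1 \<le> i" "0 \<le> b" "b \<le> 1"
  shows "1 - gap_poly (Suc i) b \<le> C_coef i * sqrt ((real i + 1 / 2) / real i) * (1 - erf (b * sqrt (real i)))"
proof -
  let ?A = "C_coef i * sqrt ((real i + 1 / 2) / real i)"
  let ?f = "\<lambda>b. ?A * (1 - erf (b * sqrt (real i))) - (1 - gap_poly (Suc i) b)"
  have "?f 1 \<le> ?f b"
  proof (rule DERIV_nonpos_imp_nonincreasing[OF assms(3)], intro exI conjI)
    fix t assume t: "b \<le> t" "t \<le> 1"
    have 2: "((\<lambda>t. erf (t * sqrt (real i))) has_real_derivative 2 / sqrt pi * exp (- (t * sqrt (real i))\<^sup>2) * sqrt (real i)) (at t)"
      using erf_has_real_derivative[OF DERIV_cmult_right[OF DERIV_ident]] by simp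
    show "(?f has_real_derivative ?A * (0 - 2 / sqrt pi * exp (- (t * sqrt (real i))\<^sup>2) * sqrt (real i))
        - (0 - (2 * real i + 1) * central i * (1 - t\<^sup>2) ^ i)) (at t)"
      by (intro DERIV_diff DERIV_cmult DERIV_const 2 gap_poly_has_derivative)
    have "(1 - t\<^sup>2) ^ i \<le> exp (- t\<^sup>2) ^ i"
      using t assms exp_ge_add_one_self[of "- t\<^sup>2"] by (intro power_mono) (auto simp: power_le_one)
    also have "\<dots> = exp (- (t * sqrt (real i))\<^sup>2)"
      by (simp add: power_mult_distrib mult.commute flip: exp_of_nat_mult)
    finally have "(2 * real i + 1) * central i * (1 - t\<^sup>2) ^ i \<le> (2 * real i + 1) * central i * exp (- (t * sqrt (real i))\<^sup>2)"
      using central_pos[of i] by (intro mult_left_mono) auto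
    also have "\<dots> = ?A * (2 / sqrt pi * exp (- (t * sqrt (real i))\<^sup>2) * sqrt (real i))"
      unfolding C_coef_central using assms(1) by (simp add: real_sqrt_divide)
    finally show "?A * (0 - 2 / sqrt pi * exp (- (t * sqrt (real i))\<^sup>2) * sqrt (real i))
        - (0 - (2 * real i + 1) * central i * (1 - t\<^sup>2) ^ i) \<le> 0" by simp
  qed
  moreover have "0 \<le> ?f 1"
    using C_coef_pos[of i] erf_less_1[of "1 * sqrt (real i)"] by simp
  ultimately show ?thesis by simp
qed

lemma gap_poly_bounds:
  assumes "0 \<le> b" "b \<le> 1"
  shows "0 \<le> gap_poly n b" "gap_poly n b \<le> 1"
proof -
  have t: "0 \<le> (1 - b\<^sup>2)" using assms by (simp add: power_le_one)
  then show "0 \<le> gap_poly n b"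
    unfolding gap_poly_def using assms central_pos
    by (intro mult_nonneg_nonneg sum_nonneg zero_le_power) (auto intro: less_imp_le)
  show "gap_poly n b \<le> 1"
  proof (cases n)
    case (Suc i)
    have "gap_poly (Suc i) b \<le> gap_poly (Suc i) 1"
    proof (rule DERIV_nonneg_imp_nondecreasing[OF assms(2)], intro exI conjI)
      fix t assume "b \<le> t" "t \<le> 1"
      then show "0 \<le> (2 * real i + 1) * central i * (1 - t\<^sup>2) ^ i"
        using assms central_pos[of i] by (intro mult_nonneg_nonneg zero_le_power) (auto simp: power_le_one)
    qed (rule gap_poly_has_derivative)
    with Suc show ?thesis by simp
  qed (simp add: gap_poly_def)
qed

lemma decseq_central_power:
  assumes "0 \<le> b" "b \<le> 1"
  shows "decseq (\<lambda>j. central j * (1 - b\<^sup>2) ^ j)"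
proof (rule decseq_SucI)
  fix n
  have "0 \<le> 1 - b\<^sup>2" "1 - b\<^sup>2 \<le> 1" using assms by (simp_all add: power_le_one)
  then show "central (Suc n) * (1 - b\<^sup>2) ^ Suc n \<le> central n * (1 - b\<^sup>2) ^ n"
    using central_antimono[of n] central_pos[of n] power_decreasing[of n "Suc n" "1 - b\<^sup>2"]
    by (intro mult_mono) (auto intro: less_imp_le)
qed

text \<open>The increments of \<open>j \<mapsto> gap_poly j b\<close> decrease and add up to at most 1.\<close>

lemma gap_increment_le:
  assumes "0 \<le> b" "b \<le> 1"
  shows "b * (central j * (1 - b\<^sup>2) ^ j) \<le> 1 / (real j + 1)"
proof -
  let ?t = "\<lambda>j. central j * (1 - b\<^sup>2) ^ j"
  note decseq_central_power[OF assms]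
  then have "(\<Sum>k<Suc j. ?t j) \<le> (\<Sum>k<Suc j. ?t k)"
    by (intro sum_mono) (auto simp: decseq_def)
  then have "b * (\<Sum>k<Suc j. ?t j) \<le> gap_poly (Suc j) b"
    unfolding gap_poly_def using assms by (intro mult_left_mono)
  also have "\<dots> \<le> 1" by (rule gap_poly_bounds[OF assms])
  finally show ?thesis by (simp add: field_simps)
qed

text \<open>For combining the Gaussian bounds at two neighbouring odd sample sizes into one at the
  interpolated size.\<close>

lemma erf_sqrt_concave:
  assumes "0 \<le> c"
  shows "concave_on {0<..} (\<lambda>x. erf (c * sqrt x))"
  unfolding concave_on_def
proof (rule convex_on_realI)
  fix x :: real assume "x \<in> {0<..}"
  then have x: "0 < x" by simp
  have "((\<lambda>x. - erf (c * sqrt x)) has_real_derivative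
      - (2 / sqrt pi * exp (- (c * sqrt x)\<^sup>2) * (c * (inverse (sqrt x) / 2)))) (at x)"
    using x by (intro DERIV_minus erf_has_real_derivative DERIV_cmult DERIV_real_sqrt)
  then show "((\<lambda>x. - erf (c * sqrt x)) has_real_derivative
      - (2 / sqrt pi * exp (- (c\<^sup>2 * x)) * (c * (inverse (sqrt x) / 2)))) (at x)"
    using x by (simp add: power_mult_distrib)
next
  fix x y :: real assume "x \<in> {0<..}" "y \<in> {0<..}" "x \<le> y"
  then show "- (2 / sqrt pi * exp (- (c\<^sup>2 * x)) * (c * (inverse (sqrt x) / 2)))
      \<le> - (2 / sqrt pi * exp (- (c\<^sup>2 * y)) * (c * (inverse (sqrt y) / 2)))"
    using assms by (intro le_imp_neg_le mult_mono) (auto simp: mult_left_mono)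
qed (auto intro: convex_connected convex_real_interval)

section \<open>The Bayes error of a biased walk\<close>

lemma measure_bind_pmf:
  "measure_pmf.prob (bind_pmf p f) A = measure_pmf.expectation p (\<lambda>x. measure_pmf.prob (f x) A)"
  unfolding measure_pmf_bind
  by (rule measure_pmf.measure_bind[where N = "count_space UNIV"])
    (auto simp: measure_pmf_in_subprob_algebra)

lemma measure_pmf_insert:
  "x \<notin> A \<Longrightarrow> measure_pmf.prob p (insert x A) = measure_pmf.prob p A + pmf p x"
  using measure_pmf.finite_measure_Union[of "{x}" p A] by (simp add: measure_pmf_single)

lemma V_pmf_0: "V_pmf 0 b = return_pmf 0"
  by (simp add: V_pmf_def)

lemma V_pmf_Suc: "V_pmf (Suc k) b = bind_pmf (Y_pmf b) (\<lambda>y. map_pmf (\<lambda>v. y + v) (V_pmf k b))"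
  by (simp add: V_pmf_def map_bind_pmf map_pmf_comp o_def map_pmf_def bind_assoc_pmf bind_return_pmf)

lemma V_pmf_binomial:
  assumes "\<bar>b\<bar> \<le> 1"
  shows "V_pmf k b = map_pmf (\<lambda>n. 2 * int n - int k) (binomial_pmf k ((1 + b) / 2))"
proof (induction k)
  case 0
  have "(1 + b) / 2 \<in> {0..1}" using assms by auto
  then show ?case by (simp add: V_pmf_0 binomial_pmf_0)
next
  case (Suc k)
  have p: "(1 + b) / 2 \<in> {0..1}" using assms by auto
  show ?case
    unfolding V_pmf_Suc Suc Y_pmf_def binomial_pmf_Suc[OF p]
    by (simp add: map_bind_pmf bind_map_pmf map_pmf_comp map_pmf_def[symmetric])
      (auto intro!: bind_pmf_cong map_pmf_cong)
qed

lemma measure_V_pmf_Suc: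
  assumes "\<bar>b\<bar> \<le> 1"
  shows "measure_pmf.prob (V_pmf (Suc k) b) A =
    (1 + b) / 2 * measure_pmf.prob (V_pmf k b) {v. v + 1 \<in> A}
    + (1 - b) / 2 * measure_pmf.prob (V_pmf k b) {v. v - 1 \<in> A}"
proof -
  have p: "0 \<le> (1 + b) / 2" "(1 + b) / 2 \<le> 1" using assms by auto
  show ?thesis
    unfolding V_pmf_Suc Y_pmf_def bind_map_pmf measure_bind_pmf
    using p by (simp add: vimage_def add.commute field_simps)
qed

text \<open>The expected sign of the walk. It agrees with \<open>s_gap k b\<close> for
  \<open>b\<close> in [0, 1], but having no absolute value it obeys a one-step recursion.\<close>

definition V_sgn :: "nat \<Rightarrow> real \<Rightarrow> real" where
  "V_sgn k b = measure_pmf.prob (V_pmf k b) {0<..} - measure_pmf.prob (V_pmf k b) {..<0}"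

text \<open>Only the states -1, 0, 1 can change sign in a step: from 0 the mean change is
  \<open>b\<close>, stepping from -1 up to 0 gains 1, and stepping from 1 down to 0 loses 1.\<close>

lemma V_sgn_Suc:
  assumes "\<bar>b\<bar> \<le> 1"
  shows "V_sgn (Suc k) b = V_sgn k b + b * pmf (V_pmf k b) 0
    + (1 + b) / 2 * pmf (V_pmf k b) (-1) - (1 - b) / 2 * pmf (V_pmf k b) 1"
proof -
  let ?P = "measure_pmf.prob (V_pmf k b)"
  have 1: "?P {v. 0 < v + 1} = ?P {0<..} + pmf (V_pmf k b) 0"
  proof -
    have "{v::int. 0 < v + 1} = {0<..} \<union> {0}" by auto
    then show ?thesis by (simp add: measure_pmf_insert)
  qed
  have 2: "?P {0<..} = ?P {v. 0 < v - 1} + pmf (V_pmf k b) 1"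
  proof -
    have "{0<..} = {v::int. 0 < v - 1} \<union> {1}" by auto
    then show ?thesis by (simp add: measure_pmf_insert)
  qed
  have 3: "?P {..<0} = ?P {v. v + 1 < 0} + pmf (V_pmf k b) (-1)"
  proof -
    have "{..<0} = {v::int. v + 1 < 0} \<union> {-1}" by auto
    then show ?thesis by (simp add: measure_pmf_insert)
  qed
  have 4: "?P {v. v - 1 < 0} = ?P {..<0} + pmf (V_pmf k b) 0"
  proof -
    have "{v::int. v - 1 < 0} = {..<0} \<union> {0}" by auto
    then show ?thesis by (simp add: measure_pmf_insert)
  qed
  show ?thesis
    unfolding V_sgn_def measure_V_pmf_Suc[OF assms] using 1 2 3 4
    by (simp add: algebra_simps add_divide_distrib diff_divide_distrib)
qed

lemma pmf_V_pmf:
  assumes "\<bar>b\<bar> \<le> 1" "n \<le> k"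
  shows "pmf (V_pmf k b) (2 * int n - int k) = real (k choose n) * ((1 + b) / 2) ^ n * ((1 - b) / 2) ^ (k - n)"
proof -
  have "inj (\<lambda>n. 2 * int n - int k)" by (auto simp: inj_on_def)
  then have "pmf (V_pmf k b) (2 * int n - int k) = pmf (binomial_pmf k ((1 + b) / 2)) n"
    unfolding V_pmf_binomial[OF assms(1)] by (rule pmf_map_inj')
  also have "\<dots> = real (k choose n) * ((1 + b) / 2) ^ n * (1 - (1 + b) / 2) ^ (k - n)"
    using assms by (subst pmf_binomial) auto
  also have "1 - (1 + b) / 2 = (1 - b) / 2" by (simp add: field_simps)
  finally show ?thesis .
qed

lemma pmf_V_pmf_parity:
  assumes "\<bar>b\<bar> \<le> 1" "odd (v + int k)"
  shows "pmf (V_pmf k b) v = 0"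
proof -
  have "v \<notin> set_pmf (V_pmf k b)"
    unfolding V_pmf_binomial[OF assms(1)] using assms(2) by auto
  then show ?thesis by (simp add: set_pmf_iff)
qed

lemma pmf_V_pmf_even_0:
  assumes "\<bar>b\<bar> \<le> 1"
  shows "pmf (V_pmf (2 * j) b) 0 = central j * (1 - b\<^sup>2) ^ j"
proof -
  have "(1 + b) / 2 * ((1 - b) / 2) = (1 - b\<^sup>2) / 4"
    by (simp add: power2_eq_square algebra_simps)
  then have "((1 + b) / 2) ^ j * ((1 - b) / 2) ^ j = ((1 - b\<^sup>2) / 4) ^ j"
    by (metis power_mult_distrib)
  then show ?thesis
    using pmf_V_pmf[OF assms, of j "2 * j"]
    by (simp add: central_def power_divide[of "1 - b\<^sup>2"] mult.assoc del: power_divide power_mult_distrib)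
qed

lemma V_sgn_eq:
  assumes "\<bar>b\<bar> \<le> 1"
  shows "V_sgn k b = gap_poly ((k + 1) div 2) b"
proof (induction k)
  case 0
  show ?case by (simp add: V_sgn_def V_pmf_0 gap_poly_def)
next
  case (Suc k)
  show ?case
  proof (cases "even k")
    case True
    then obtain j where k: "k = 2 * j" by auto
    have "V_sgn (Suc k) b = V_sgn k b + b * pmf (V_pmf k b) 0"
      unfolding V_sgn_Suc[OF assms] using k by (simp add: pmf_V_pmf_parity[OF assms])
    then show ?thesis
      unfolding Suc unfolding k pmf_V_pmf_even_0[OF assms] by (simp add: gap_poly_def distrib_left)
  next
    case False
    then obtain j where k: "k = 2 * j + 1" by (auto elim: oddE)
    have m: "pmf (V_pmf k b) (-1) = real (k choose j) * ((1 + b) / 2) ^ j * ((1 - b) / 2) ^ (j + 1)"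
      using pmf_V_pmf[OF assms, of j k] k by simp
    have p: "pmf (V_pmf k b) 1 = real (k choose (j + 1)) * ((1 + b) / 2) ^ (j + 1) * ((1 - b) / 2) ^ j"
      using pmf_V_pmf[OF assms, of "j + 1" k] k by simp
    \<comment> \<open>At odd times the gain from -1 and the loss from 1 have the same
      weight.\<close>
    have "k choose (j + 1) = k choose j"
      using binomial_symmetric[of "j + 1" k] k by simp
    then have "V_sgn (Suc k) b = V_sgn k b + b * pmf (V_pmf k b) 0"
      unfolding V_sgn_Suc[OF assms] m p by simp
    also have "pmf (V_pmf k b) 0 = 0"
      using k by (simp add: pmf_V_pmf_parity[OF assms])
    finally show ?thesis using Suc k by simp
  qed
qed

lemma V_pmf_uminus:
  assumes "\<bar>b\<bar> \<le> 1"
  shows "V_pmf k (- b) = map_pmf uminus (V_pmf k b)"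
proof (induction k)
  case (Suc k)
  have p: "0 \<le> (1 + b) / 2" "(1 + b) / 2 \<le> 1" "0 \<le> (1 - b) / 2" "(1 - b) / 2 \<le> 1" using assms by auto
  have "bernoulli_pmf ((1 - b) / 2) = map_pmf Not (bernoulli_pmf ((1 + b) / 2))"
  proof (rule pmf_eqI)
    fix t
    have "pmf (map_pmf Not (bernoulli_pmf ((1 + b) / 2))) (\<not> \<not> t) = pmf (bernoulli_pmf ((1 + b) / 2)) (\<not> t)"
      by (rule pmf_map_inj') (auto simp: inj_on_def)
    then show "pmf (bernoulli_pmf ((1 - b) / 2)) t = pmf (map_pmf Not (bernoulli_pmf ((1 + b) / 2))) t"
      using p by (cases t) (auto simp: field_simps)
  qed
  then have "Y_pmf (- b) = map_pmf uminus (Y_pmf b)"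
    unfolding Y_pmf_def by (auto simp: map_pmf_comp intro!: map_pmf_cong)
  then show ?case
    unfolding V_pmf_Suc Suc by (simp add: map_bind_pmf bind_map_pmf map_pmf_comp)
qed (simp add: V_pmf_0)

lemma s_gap_eq:
  assumes "0 \<le> b" "b \<le> 1"
  shows "s_gap k b = gap_poly ((k + 1) div 2) b"
proof -
  have b: "\<bar>b\<bar> \<le> 1" using assms by simp
  have "measure_pmf.prob (V_pmf k (- b)) {0<..} = measure_pmf.prob (V_pmf k b) {..<0}"
    unfolding V_pmf_uminus[OF b] by (simp add: vimage_def lessThan_def)
  then have "s_gap k b = \<bar>V_sgn k b\<bar>" by (simp add: s_gap_def V_sgn_def)
  then show ?thesis using gap_poly_bounds[OF assms] by (simp add: V_sgn_eq[OF b])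
qed

lemma bayes_eq:
  assumes "0 \<le> b" "b \<le> 1"
  shows "bayes k b = (1 - gap_poly ((k + 1) div 2) b) / 2"
  by (simp add: bayes_def s_gap_eq[OF assms])

lemma bayes_bounds:
  assumes "0 \<le> b" "b \<le> 1"
  shows "0 \<le> bayes k b" "bayes k b \<le> 1 / 2"
  using gap_poly_bounds[OF assms] by (auto simp: bayes_eq[OF assms])

text \<open>\<open>bayes\<close> is the error probability when ties are decided by a fair coin, so
  it is the midpoint of the error probabilities under the two fixed tie rules.\<close>

lemma prob_V_pmf_nonpos:
  assumes "0 \<le> b" "b \<le> 1"
  shows "measure_pmf.prob (V_pmf k b) {..0} = bayes k b + pmf (V_pmf k b) 0 / 2"
    and "measure_pmf.prob (V_pmf k b) {..<0} = bayes k b - pmf (V_pmf k b) 0 / 2"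
proof -
  let ?P = "measure_pmf.prob (V_pmf k b)"
  have b: "\<bar>b\<bar> \<le> 1" using assms by simp
  have 1: "?P {..0} = ?P {..<0} + pmf (V_pmf k b) 0"
  proof -
    have "{..0::int} = {..<0} \<union> {0}" by auto
    then show ?thesis by (simp add: measure_pmf_insert)
  qed
  have "?P {..0} = 1 - ?P {0<..}"
  proof -
    have "{..0::int} = UNIV - {0<..}" by auto
    then show ?thesis using measure_pmf.prob_compl[of "{0<..}" "V_pmf k b"] by simp
  qed
  with 1 show "?P {..0} = bayes k b + pmf (V_pmf k b) 0 / 2" "?P {..<0} = bayes k b - pmf (V_pmf k b) 0 / 2"
    using V_sgn_eq[OF b, of k] by (auto simp: bayes_eq[OF assms] V_sgn_def field_simps)
qed

section \<open>Comparison of the bounds\<close>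

lemma i_idx_bounds:
  assumes "1 \<le> \<nu>"
  shows "2 * real (i_idx \<nu>) + 1 \<le> \<nu>" "\<nu> < 2 * real (i_idx \<nu>) + 3"
proof -
  have "0 \<le> \<lfloor>(\<nu> - 1) / 2\<rfloor>" using assms by simp
  then have i: "real (i_idx \<nu>) = of_int \<lfloor>(\<nu> - 1) / 2\<rfloor>" by (simp add: i_idx_def)
  show "2 * real (i_idx \<nu>) + 1 \<le> \<nu>"
    using of_int_floor_le[of "(\<nu> - 1) / 2"] unfolding i by argo
  show "\<nu> < 2 * real (i_idx \<nu>) + 3"
    using real_of_int_floor_add_one_gt[of "(\<nu> - 1) / 2"] unfolding i by argo
qed

lemma i_idx_ge_1: "3 \<le> \<nu> \<Longrightarrow> 1 \<le> i_idx \<nu>"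
  using i_idx_bounds[of \<nu>] by linarith

lemma B2_tilde_le_B2:
  assumes "3 \<le> \<nu>"
  shows "B2_tilde \<nu> \<le> B2 \<nu>"
  unfolding B2_tilde_def B2_def
  using z_star_pos assms erf_pos[of "z_star / sqrt 2"]
  by (intro mult_left_mono diff_left_mono mult_right_mono C_coef_le_powr i_idx_ge_1) auto

lemma bayes_interp_eq:
  assumes "1 < \<nu>" "0 \<le> b" "b \<le> 1"
  defines "i \<equiv> i_idx \<nu>"
  shows "bayes_interp \<nu> b = (1 - ((2 * real i + 3 - \<nu>) / 2 * gap_poly (Suc i) b
    + (\<nu> - 2 * real i - 1) / 2 * gap_poly (Suc (Suc i)) b)) / 2"
proof -
  have e: "(2 * i + 1 + 1) div 2 = Suc i" "(2 * i + 3 + 1) div 2 = Suc (Suc i)" by simp_all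
  show ?thesis
    using assms(1) unfolding bayes_interp_def Let_def bayes_eq[OF assms(2,3)] i_def[symmetric] e
    by (simp add: field_simps)
qed

lemma bdd_above_B1:
  assumes "1 < \<nu>"
  shows "bdd_above ((\<lambda>b. b * bayes_interp \<nu> b) ` {0<..<1})"
proof (rule bdd_aboveI2)
  fix b :: real assume b: "b \<in> {0<..<1}"
  have w: "0 \<le> (2 * real (i_idx \<nu>) + 3 - \<nu>) / 2" "0 \<le> (\<nu> - 2 * real (i_idx \<nu>) - 1) / 2"
    using i_idx_bounds[of \<nu>] assms by auto
  have "bayes_interp \<nu> b \<le> 1 / 2"
    using b mult_nonneg_nonneg[OF w(1) gap_poly_bounds(1)[of b "Suc (i_idx \<nu>)"]]
      mult_nonneg_nonneg[OF w(2) gap_poly_bounds(1)[of b "Suc (Suc (i_idx \<nu>))"]]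
    by (subst bayes_interp_eq[OF assms]) auto
  then have "b * bayes_interp \<nu> b \<le> b * (1 / 2)"
    using b by (intro mult_left_mono) auto
  also have "\<dots> \<le> 1" using b by simp
  finally show "b * bayes_interp \<nu> b \<le> 1" .
qed

lemma B2_le_B1:
  assumes "3 \<le> \<nu>"
  shows "B2 \<nu> \<le> B1 \<nu>"
proof -
  define i where "i = i_idx \<nu>"
  \<comment> \<open>The bias for which the Gaussian approximation of b times the Bayes error is
    \<open>limit_objective z_star / sqrt \<nu>\<close>.\<close>
  define b where "b = z_star / sqrt \<nu>"
  define c where "c = b / sqrt 2"
  have i1: "1 \<le> i" using i_idx_ge_1[OF assms] by (simp add: i_def)
  have i: "2 * real i + 1 \<le> \<nu>" "\<nu> < 2 * real i + 3"
    using i_idx_bounds[of \<nu>] assms by (simp_all add: i_def)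
  have "1 < sqrt \<nu>" using assms by simp
  with z_star_less_1 have "z_star < sqrt \<nu>" by linarith
  then have b: "0 < b" "b < 1"
    using z_star_pos assms by (auto simp: b_def)
  then have c: "0 < c" by (simp add: c_def)
  \<comment> \<open>In terms of \<open>c\<close> the argument of erf depends on the interpolation
    node 2 j + 1 itself, so concavity can be applied in the node.\<close>
  have root: "b * sqrt (real j + 1 / 2) = c * sqrt (2 * real j + 1)" for j
  proof -
    have "real j + 1 / 2 = (2 * real j + 1) / 2" by simp
    then have "sqrt (real j + 1 / 2) = sqrt (2 * real j + 1) / sqrt 2"
      by (simp only: real_sqrt_divide)
    then show ?thesis by (simp add: c_def)
  qed
  let ?w1 = "(2 * real i + 3 - \<nu>) / 2" and ?w2 = "(\<nu> - 2 * real i - 1) / 2"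
  let ?E = "\<lambda>x. erf (c * sqrt x)"
  have w: "0 \<le> ?w1" "0 \<le> ?w2" "?w1 + ?w2 = 1" using i by (auto simp: field_simps)
  have g1: "gap_poly (Suc i) b \<le> C_coef i * exp (b\<^sup>2 / 6) * ?E (2 * real i + 1)"
    using gap_poly_le_erf[OF i1, of b] b by (simp add: root mult.assoc)
  have "gap_poly (Suc (Suc i)) b \<le> C_coef (Suc i) * exp (b\<^sup>2 / 6) * ?E (2 * real (Suc i) + 1)"
    using gap_poly_le_erf[of "Suc i" b] b root[of "Suc i"] by (simp add: mult.assoc)
  \<comment> \<open>C_i decreases in i, so both nodes may carry the same coefficient.\<close>
  also have "\<dots> \<le> C_coef i * exp (b\<^sup>2 / 6) * ?E (2 * real i + 3)"
    using C_coef_Suc_le[of i] c by (simp add: mult_right_mono erf_nonneg algebra_simps)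
  finally have g2: "gap_poly (Suc (Suc i)) b \<le> C_coef i * exp (b\<^sup>2 / 6) * ?E (2 * real i + 3)" .
  have "?w1 * ?E (2 * real i + 1) + ?w2 * ?E (2 * real i + 3)
      \<le> ?E (?w1 * (2 * real i + 1) + ?w2 * (2 * real i + 3))"
  proof -
    have conc: "(1 - t) * ?E x + t * ?E y \<le> ?E ((1 - t) * x + t * y)"
      if "0 \<le> t" "t \<le> 1" "0 < x" "0 < y" for t x y
      using concave_onD[OF erf_sqrt_concave[of c], of t x y] that c by simp
    have "0 \<le> ?w2 \<Longrightarrow> ?w2 \<le> 1 \<Longrightarrow> (1 - ?w2) * ?E (2 * real i + 1) + ?w2 * ?E (2 * real i + 3)
        \<le> ?E ((1 - ?w2) * (2 * real i + 1) + ?w2 * (2 * real i + 3))"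
      by (rule conc) simp_all
    moreover have "1 - ?w2 = ?w1" "?w2 \<le> 1" using w by linarith+
    ultimately show ?thesis using w(2) by metis
  qed
  also have "?w1 * (2 * real i + 1) + ?w2 * (2 * real i + 3) = \<nu>"
    by (simp add: field_simps)
  also have "c * sqrt \<nu> = z_star / sqrt 2"
    using assms by (simp add: c_def b_def)
  finally have conc: "?w1 * ?E (2 * real i + 1) + ?w2 * ?E (2 * real i + 3) \<le> erf (z_star / sqrt 2)" .
  have "?w1 * gap_poly (Suc i) b + ?w2 * gap_poly (Suc (Suc i)) b
      \<le> ?w1 * (C_coef i * exp (b\<^sup>2 / 6) * ?E (2 * real i + 1)) + ?w2 * (C_coef i * exp (b\<^sup>2 / 6) * ?E (2 * real i + 3))"
    using g1 g2 w by (intro add_mono mult_left_mono)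
  also have "\<dots> = C_coef i * exp (b\<^sup>2 / 6) * (?w1 * ?E (2 * real i + 1) + ?w2 * ?E (2 * real i + 3))"
    by (simp only: distrib_left mult_ac)
  also have "\<dots> \<le> C_coef i * exp (b\<^sup>2 / 6) * erf (z_star / sqrt 2)"
    using C_coef_pos[of i] by (intro mult_left_mono conc) simp
  also have "\<dots> = C_coef i * (erf (z_star / sqrt 2) / exp (- z_star\<^sup>2 / (6 * \<nu>)))"
  proof -
    have "b\<^sup>2 / 6 = z_star\<^sup>2 / (6 * \<nu>)" using assms by (simp add: b_def power_divide)
    then have "exp (- z_star\<^sup>2 / (6 * \<nu>)) = inverse (exp (b\<^sup>2 / 6))"
      by (simp flip: exp_minus)
    then show ?thesis by (simp only: divide_inverse inverse_inverse_eq mult_ac)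
  qed
  finally have "(1 - C_coef i * (erf (z_star / sqrt 2) / exp (- z_star\<^sup>2 / (6 * \<nu>)))) / 2 \<le> bayes_interp \<nu> b"
    using b assms unfolding i_def by (subst bayes_interp_eq) auto
  then have "b * ((1 - C_coef i * (erf (z_star / sqrt 2) / exp (- z_star\<^sup>2 / (6 * \<nu>)))) / 2) \<le> b * bayes_interp \<nu> b"
    using b by (intro mult_left_mono) auto
  also have "\<dots> \<le> B1 \<nu>"
    unfolding B1_def using b assms by (intro cSUP_upper bdd_above_B1) auto
  also have "b * ((1 - C_coef i * (erf (z_star / sqrt 2) / exp (- z_star\<^sup>2 / (6 * \<nu>)))) / 2) = B2 \<nu>"
    by (simp add: B2_def b_def i_def)
  finally show ?thesis .
qed

section \<open>Binomial moments and Jensen's inequality\<close>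

lemma expectation_binomial_pmf_Suc:
  fixes f :: "nat \<Rightarrow> real"
  assumes "p \<in> {0..1}"
  shows "measure_pmf.expectation (binomial_pmf (Suc n) p) f =
    p * measure_pmf.expectation (binomial_pmf n p) (\<lambda>k. f (Suc k))
    + (1 - p) * measure_pmf.expectation (binomial_pmf n p) f"
proof -
  have "binomial_pmf (Suc n) p =
      bernoulli_pmf p \<bind> (\<lambda>b. map_pmf (\<lambda>k. (if b then 1 else 0) + k) (binomial_pmf n p))"
    by (simp add: binomial_pmf_Suc[OF assms] map_pmf_def)
  moreover have "measure_pmf.expectation
        (bernoulli_pmf p \<bind> (\<lambda>b. map_pmf (\<lambda>k. (if b then 1 else 0) + k) (binomial_pmf n p))) f
      = (\<Sum>b\<in>UNIV. pmf (bernoulli_pmf p) b *\<^sub>R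
          measure_pmf.expectation (map_pmf (\<lambda>k. (if b then 1 else 0) + k) (binomial_pmf n p)) f)"
    using assms by (intro pmf_expectation_bind) (auto intro!: finite_imageI finite_set_pmf_binomial_pmf)
  ultimately show ?thesis
    using assms by (simp add: UNIV_bool)
qed

lemma expectation_binomial_id:
  assumes "p \<in> {0..1}"
  shows "measure_pmf.expectation (binomial_pmf n p) real = real n * p"
proof (induction n)
  case (Suc n)
  then show ?case
    using assms by (simp add: expectation_binomial_pmf_Suc integral_add algebra_simps)
qed (simp add: binomial_pmf_0[OF assms])

lemma variance_binomial:
  assumes "p \<in> {0..1}"
  shows "measure_pmf.expectation (binomial_pmf n p) (\<lambda>k. (real k - real n * p)\<^sup>2) = real n * p * (1 - p)"
proof -
  have sq: "measure_pmf.expectation (binomial_pmf n p) (\<lambda>k. (real k)\<^sup>2) = real n * p * (1 - p) + (real n * p)\<^sup>2"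
  proof (induction n)
    case (Suc n)
    have e: "(real (Suc k))\<^sup>2 = (real k)\<^sup>2 + 2 * real k + 1" for k
      by (simp add: power2_eq_square algebra_simps)
    show ?case
      using assms
      by (simp add: expectation_binomial_pmf_Suc e Suc expectation_binomial_id integral_add del: of_nat_Suc)
        (simp add: power2_eq_square algebra_simps)
  qed (simp add: binomial_pmf_0[OF assms])
  have "(real k - real n * p)\<^sup>2 = (real k)\<^sup>2 - 2 * (real n * p) * real k + (real n * p)\<^sup>2" for k
    by (simp add: power2_diff)
  then show ?thesis
    using assms by (simp add: integral_add integral_diff sq expectation_binomial_id) (simp add: power2_eq_square)
qed

text \<open>A sequence with decreasing increments lies below the line through two consecutive
  members, on either side of them. Here these have the indices \<open>i\<close> and
  \<open>Suc i\<close>, which belong to the odd times 2 i - 1 and 2 i + 1.\<close>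

lemma gap_poly_le_line:
  assumes "0 \<le> b" "b \<le> 1"
  shows "gap_poly ((k + 1) div 2) b \<le>
    gap_poly i b + (real k + 1 - 2 * real i) / 2 * (b * (central i * (1 - b\<^sup>2) ^ i))"
proof -
  let ?d = "\<lambda>i. b * (central i * (1 - b\<^sup>2) ^ i)"
  define n where "n = (k + 1) div 2"
  have b: "0 \<le> 1 - b\<^sup>2" using assms by (simp add: power_le_one)
  have d: "decseq ?d"
    using decseq_central_power[OF assms] assms(1) by (auto simp: decseq_def intro: mult_left_mono)
  have d0: "0 \<le> ?d i" using assms b central_pos[of i] by simp
  have gap: "gap_poly j b = (\<Sum>l<j. ?d l)" for j
    by (simp add: gap_poly_def sum_distrib_left)
  have "gap_poly n b \<le> gap_poly i b + (real n - real i) * ?d i"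
  proof (cases "i \<le> n")
    case True
    have "gap_poly n b = gap_poly i b + (\<Sum>l=i..<n. ?d l)"
      unfolding gap using sum.atLeastLessThan_concat[of 0 i n ?d] True by (simp add: atLeast0LessThan)
    also have "(\<Sum>l=i..<n. ?d l) \<le> (\<Sum>l=i..<n. ?d i)"
      by (intro sum_mono decseqD[OF d]) auto
    finally show ?thesis using True by (simp add: of_nat_diff)
  next
    case False
    have "gap_poly i b = gap_poly n b + (\<Sum>l=n..<i. ?d l)"
      unfolding gap using sum.atLeastLessThan_concat[of 0 n i ?d] False by (simp add: atLeast0LessThan)
    moreover have "(\<Sum>l=n..<i. ?d i) \<le> (\<Sum>l=n..<i. ?d l)"
      by (intro sum_mono decseqD[OF d]) auto
    ultimately show ?thesis using False by (simp add: of_nat_diff algebra_simps)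
  qed
  \<comment> \<open>For odd \<open>k\<close> this is an equality. For even \<open>k\<close> the
    division rounds down by 1/2, which is harmless because the increment is nonnegative.\<close>
  also have "\<dots> \<le> gap_poly i b + (real k + 1 - 2 * real i) / 2 * ?d i"
  proof (intro add_left_mono mult_right_mono d0)
    have "2 * n \<le> k + 1" by (simp add: n_def)
    then have "2 * real n \<le> real k + 1" by linarith
    then show "real n - real i \<le> (real k + 1 - 2 * real i) / 2" by simp
  qed
  finally show ?thesis by (simp add: n_def)
qed

lemma bdd_above_B0:
  assumes "p \<in> {0..1}"
  shows "bdd_above ((\<lambda>b. b * measure_pmf.expectation (binomial_pmf m p) (\<lambda>N. bayes N b)) ` {0..1})"
proof (rule bdd_aboveI2)
  fix b :: real assume b: "b \<in> {0..1}"
  have "measure_pmf.expectation (binomial_pmf m p) (\<lambda>N. bayes N b)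
      \<le> measure_pmf.expectation (binomial_pmf m p) (\<lambda>N. 1)"
    using b bayes_bounds[of b] assms
    by (intro integral_mono) (auto intro: order_trans[of _ "1 / 2"])
  then have "b * measure_pmf.expectation (binomial_pmf m p) (\<lambda>N. bayes N b) \<le> b * 1"
    using b by (intro mult_left_mono) auto
  then show "b * measure_pmf.expectation (binomial_pmf m p) (\<lambda>N. bayes N b) \<le> 1" using b by simp
qed

text \<open>The minorant touches the Bayes error at the two odd points around \<nu> = m / d. Its
  expectation is its value at the mean \<nu>, and this is the interpolated Bayes error.\<close>

lemma B1_le_B0:
  assumes "1 \<le> d" "3 \<le> real m / real d"
  shows "B1 (real m / real d) \<le> B0 m d"
proof -
  define \<nu> where "\<nu> = real m / real d"
  define i where "i = i_idx \<nu>"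
  have p: "1 / real d \<in> {0..1}" using assms by simp
  have "b * bayes_interp \<nu> b \<le> B0 m d" if b: "b \<in> {0<..<1}" for b
  proof -
    have b': "0 \<le> b" "b \<le> 1" using b by auto
    define D where "D = b * (central (Suc i) * (1 - b\<^sup>2) ^ Suc i)"
    have interp: "bayes_interp \<nu> b = (1 - (gap_poly (Suc i) b + (\<nu> - 1 - 2 * real i) / 2 * D)) / 2"
    proof -
      have "gap_poly (Suc (Suc i)) b = gap_poly (Suc i) b + D"
        by (simp add: gap_poly_def D_def distrib_left)
      then show ?thesis
        using bayes_interp_eq[OF _ b', of \<nu>] assms unfolding \<nu>_def[symmetric] i_def[symmetric]
        by (simp add: field_simps)
    qed
    have "measure_pmf.expectation (binomial_pmf m (1 / real d))
          (\<lambda>N. (1 - gap_poly (Suc i) b - (real N - 1 - 2 * real i) / 2 * D) / 2)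
        \<le> measure_pmf.expectation (binomial_pmf m (1 / real d)) (\<lambda>N. bayes N b)"
    proof (intro integral_mono integrable_binomial_pmf p)
      fix N
      show "(1 - gap_poly (Suc i) b - (real N - 1 - 2 * real i) / 2 * D) / 2 \<le> bayes N b"
        using gap_poly_le_line[OF b', of N "Suc i"]
        unfolding D_def[symmetric] bayes_eq[OF b'] by (simp add: field_simps)
    qed
    also have "measure_pmf.expectation (binomial_pmf m (1 / real d))
          (\<lambda>N. (1 - gap_poly (Suc i) b - (real N - 1 - 2 * real i) / 2 * D) / 2) = bayes_interp \<nu> b"
    proof -
      have "(\<lambda>N. (1 - gap_poly (Suc i) b - (real N - 1 - 2 * real i) / 2 * D) / 2)
          = (\<lambda>N. (1 - gap_poly (Suc i) b + (1 + 2 * real i) / 2 * D) / 2 - D / 4 * real N)"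
        by (simp add: fun_eq_iff field_simps)
      then show ?thesis
        unfolding interp using p expectation_binomial_id[OF p, of m]
        by (simp add: integral_diff \<nu>_def) (simp add: field_simps)
    qed
    finally have "b * bayes_interp \<nu> b
        \<le> b * measure_pmf.expectation (binomial_pmf m (1 / real d)) (\<lambda>N. bayes N b)"
      using b' by (intro mult_left_mono)
    also have "\<dots> \<le> B0 m d"
      unfolding B0_def using b' by (intro cSUP_upper bdd_above_B0 p) auto
    finally show ?thesis .
  qed
  then show ?thesis
    unfolding B1_def \<nu>_def by (intro cSUP_least) auto
qed

section \<open>Asymptotics of the explicit bound and of the weighted error probability\<close>

lemma filterlim_i_idx: "filterlim i_idx at_top at_top"
  unfolding filterlim_at_top
proof
  fix n
  show "\<forall>\<^sub>F \<nu> in at_top. n \<le> i_idx \<nu>"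
    using eventually_ge_at_top[of "2 * real n + 3"]
  proof eventually_elim
    case (elim \<nu>)
    then show ?case using i_idx_bounds(2)[of \<nu>] by linarith
  qed
qed

lemma tendsto_B2_tilde: "((\<lambda>\<nu>. B2_tilde \<nu> * sqrt \<nu>) \<longlongrightarrow> c_infty) at_top"
proof -
  let ?e = "erf (z_star / sqrt 2)"
  have 1: "((\<lambda>\<nu>. ((real (i_idx \<nu>) + 1) / real (i_idx \<nu>)) powr (1 / 8)) \<longlongrightarrow> 1 powr (1 / 8)) at_top"
  proof (intro tendsto_powr tendsto_const)
    have "(\<lambda>n. (real n + 1) / real n) \<longlonglongrightarrow> 1"
      by real_asymp
    from filterlim_compose[OF this filterlim_i_idx]
    show "((\<lambda>\<nu>. (real (i_idx \<nu>) + 1) / real (i_idx \<nu>)) \<longlongrightarrow> 1) at_top" .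
  qed simp
  have 2: "((\<lambda>\<nu>. exp (- z_star\<^sup>2 / (6 * \<nu>))) \<longlongrightarrow> 1) at_top"
    by real_asymp
  have "((\<lambda>\<nu>. z_star / 2 * (1 - ((real (i_idx \<nu>) + 1) / real (i_idx \<nu>)) powr (1 / 8)
        * (?e / exp (- z_star\<^sup>2 / (6 * \<nu>))))) \<longlongrightarrow> z_star / 2 * (1 - 1 powr (1 / 8) * (?e / 1))) at_top"
    by (intro tendsto_intros 1 2) simp
  also have "z_star / 2 * (1 - 1 powr (1 / 8) * (?e / 1)) = c_infty"
    by (simp add: c_infty_eq limit_objective_def)
  finally show ?thesis
  proof (rule Lim_transform_eventually)
    show "\<forall>\<^sub>F \<nu> in at_top. z_star / 2 * (1 - ((real (i_idx \<nu>) + 1) / real (i_idx \<nu>)) powr (1 / 8)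
        * (?e / exp (- z_star\<^sup>2 / (6 * \<nu>)))) = B2_tilde \<nu> * sqrt \<nu>"
      using eventually_gt_at_top[of 0] by eventually_elim (simp add: B2_tilde_def)
  qed
qed

lemma bias_bayes_le:
  assumes "3 \<le> n" "0 \<le> b" "b \<le> 1"
  shows "b * bayes n b \<le> C_coef ((n - 1) div 2) * (sqrt (real n) / (real n - 2)) * c_infty"
proof -
  define i where "i = (n - 1) div 2"
  have i: "1 \<le> i" "2 * i + 1 \<le> n" "n \<le> 2 * i + 2" "(n + 1) div 2 = Suc i"
    using assms(1) by (auto simp: i_def)
  have i': "0 < real i" "2 * real i + 1 \<le> real n" "real n - 2 \<le> 2 * real i" "0 < real n - 2"
    using i assms(1) by linarith+
  have "b * bayes n b = b / 2 * (1 - gap_poly (Suc i) b)"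
    using i by (simp add: bayes_eq[OF assms(2,3)])
  also have "\<dots> \<le> b / 2 * (C_coef i * sqrt ((real i + 1 / 2) / real i) * (1 - erf (b * sqrt (real i))))"
    using assms i by (intro mult_left_mono one_minus_gap_poly_le_erfc) auto
  also have "\<dots> = C_coef i * (sqrt ((real i + 1 / 2) / real i) / sqrt (2 * real i)) * limit_objective (b * sqrt (2 * real i))"
    using i' by (simp add: limit_objective_def real_sqrt_mult)
  also have "\<dots> \<le> C_coef i * (sqrt ((real i + 1 / 2) / real i) / sqrt (2 * real i)) * c_infty"
    using assms C_coef_pos[of i] by (intro mult_left_mono limit_objective_le_c_infty) auto
  also have "sqrt ((real i + 1 / 2) / real i) / sqrt (2 * real i) = sqrt (2 * real i + 1) / (2 * real i)"
  proof -
    have "sqrt ((real i + 1 / 2) / real i) / sqrt (2 * real i) = sqrt ((2 * real i + 1) / (2 * real i)\<^sup>2)"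
      using i' by (simp add: power2_eq_square field_simps flip: real_sqrt_divide)
    then show ?thesis using i'(1) by (simp only: real_sqrt_divide real_sqrt_abs)
  qed
  \<comment> \<open>\<open>n\<close> is \<open>2 * i + 1\<close> or \<open>2 * i + 2\<close>, so
    passing to \<open>n\<close> treats both parities at once.\<close>
  also have "C_coef i * (sqrt (2 * real i + 1) / (2 * real i)) * c_infty
      \<le> C_coef i * (sqrt (real n) / (real n - 2)) * c_infty"
    using i' C_coef_pos[of i] c_infty_pos
    by (intro mult_right_mono mult_left_mono frac_le) auto
  finally show ?thesis by (simp add: i_def)
qed

text \<open>The tie term b P(V = 0) is an increment of \<open>gap_poly\<close>. For even n = 2 j it
  is at most 1 / (j + 1), which is O(1 / n) uniformly in \<open>b\<close>; for odd \<open>n\<close>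
  it vanishes.\<close>

lemma bias_prob_nonpos_le:
  assumes "3 \<le> n" "0 \<le> b" "b \<le> 1"
  shows "b * measure_pmf.prob (V_pmf n b) {..0} \<le>
    C_coef ((n - 1) div 2) * (sqrt (real n) / (real n - 2)) * c_infty + 1 / real n"
proof -
  have "b * pmf (V_pmf n b) 0 \<le> 2 / real n"
  proof (cases "even n")
    case True
    then obtain j where n: "n = 2 * j" by auto
    have "b * pmf (V_pmf n b) 0 \<le> 1 / (real j + 1)"
      using gap_increment_le[OF assms(2,3), of j] assms by (simp add: n pmf_V_pmf_even_0)
    also have "\<dots> \<le> 1 / real j"
      using assms(1) n by (intro divide_left_mono) auto
    finally show ?thesis using n by simp
  next
    case False
    then have "pmf (V_pmf n b) 0 = 0"
      using assms by (intro pmf_V_pmf_parity) auto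
    then show ?thesis by simp
  qed
  with bias_bayes_le[OF assms] show ?thesis
    by (simp add: prob_V_pmf_nonpos[OF assms(2,3)] distrib_left)
qed

lemma eventually_bias_prob_nonpos_le:
  assumes "c_infty < c"
  shows "\<exists>n0\<ge>1. \<forall>n\<ge>n0. \<forall>b. 0 \<le> b \<longrightarrow> b \<le> 1 \<longrightarrow> b * measure_pmf.prob (V_pmf n b) {..0} \<le> c / sqrt (real n)"
proof -
  have half: "filterlim (\<lambda>n::nat. (n - 1) div 2) at_top at_top"
    unfolding filterlim_at_top
  proof
    fix k show "\<forall>\<^sub>F n::nat in sequentially. k \<le> (n - 1) div 2"
      using eventually_ge_at_top[of "2 * k + 1"] by eventually_elim auto
  qed
  have "(\<lambda>n. C_coef ((n - 1) div 2) * (real n / (real n - 2)) * c_infty + 1 / sqrt (real n)) \<longlonglongrightarrow> 1 * 1 * c_infty + 0"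
  proof (intro tendsto_intros filterlim_compose[OF tendsto_C_coef half])
    show "(\<lambda>n. real n / (real n - 2)) \<longlonglongrightarrow> 1" by real_asymp
    show "(\<lambda>n. 1 / sqrt (real n)) \<longlonglongrightarrow> 0" by real_asymp
  qed
  with assms have "\<forall>\<^sub>F n in sequentially. C_coef ((n - 1) div 2) * (real n / (real n - 2)) * c_infty + 1 / sqrt (real n) < c"
    by (intro order_tendstoD) auto
  then obtain N where N: "\<And>n. N \<le> n \<Longrightarrow> C_coef ((n - 1) div 2) * (real n / (real n - 2)) * c_infty + 1 / sqrt (real n) < c"
    by (auto simp: eventually_sequentially)
  have "b * measure_pmf.prob (V_pmf n b) {..0} \<le> c / sqrt (real n)"
    if n: "max N 3 \<le> n" and b: "0 \<le> b" "b \<le> 1" for n b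
  proof -
    have s: "0 < sqrt (real n)" "sqrt (real n) * sqrt (real n) = real n" using n by auto
    have "b * measure_pmf.prob (V_pmf n b) {..0} \<le>
        C_coef ((n - 1) div 2) * (sqrt (real n) / (real n - 2)) * c_infty + 1 / real n"
      using n b by (intro bias_prob_nonpos_le) auto
    also have "\<dots> = (C_coef ((n - 1) div 2) * (sqrt (real n) * sqrt (real n) / (real n - 2)) * c_infty
        + sqrt (real n) / (sqrt (real n) * sqrt (real n))) / sqrt (real n)"
      using s(1) by (simp add: add_divide_distrib del: real_sqrt_mult_self) (simp add: s)
    also have "\<dots> \<le> c / sqrt (real n)"
    proof (intro divide_right_mono)
      have "sqrt (real n) / (sqrt (real n) * sqrt (real n)) = 1 / sqrt (real n)"
        using s(1) by (simp add: real_divide_square_eq del: real_sqrt_mult_self)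
      then show "C_coef ((n - 1) div 2) * (sqrt (real n) * sqrt (real n) / (real n - 2)) * c_infty
          + sqrt (real n) / (sqrt (real n) * sqrt (real n)) \<le> c"
        using N[of n] n unfolding s(2) by simp
    qed simp
    finally show ?thesis .
  qed
  then show ?thesis by (intro exI[of _ "max N 3"]) auto
qed

text \<open>By Chebyshev's inequality the binomial number of relevant examples may be replaced by
  \<open>(1 - \<eta>) m p\<close>.\<close>

lemma expected_bias_prob_nonpos_le:
  assumes "c_infty < c"
  shows "\<exists>K>0. \<forall>m p b. 0 < p \<longrightarrow> p \<le> 1 \<longrightarrow> 0 \<le> b \<longrightarrow> b \<le> 1 \<longrightarrow> K \<le> real m * p \<longrightarrow>
    b * measure_pmf.expectation (binomial_pmf m p) (\<lambda>N. measure_pmf.prob (V_pmf N b) {..0})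
      \<le> c / sqrt (real m * p)"
proof -
  define c' where "c' = (c_infty + c) / 2"
  define c'' where "c'' = (c' + c) / 2"
  have c: "c_infty < c'" "c' < c''" "c'' < c" "0 < c'" using assms c_infty_pos by (auto simp: c'_def c''_def)
  obtain n0 where n0: "n0 \<ge> 1"
    "\<And>n b. n0 \<le> n \<Longrightarrow> 0 \<le> b \<Longrightarrow> b \<le> 1 \<Longrightarrow> b * measure_pmf.prob (V_pmf n b) {..0} \<le> c' / sqrt (real n)"
    using eventually_bias_prob_nonpos_le[OF c(1)] by blast
  \<comment> \<open>This \<open>r\<close> turns the constant \<open>c'\<close> at
    \<open>r\<^sup>2 * x\<close> examples into \<open>c''\<close> at \<open>x\<close> examples. The
    gap from \<open>c''\<close> to \<open>c\<close> is left for the deviations.\<close>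
  define r where "r = c' / c''"
  define \<eta> where "\<eta> = 1 - r\<^sup>2"
  have r: "0 < r" "r < 1" using c by (auto simp: r_def)
  then have r2: "0 < r\<^sup>2" "r\<^sup>2 < 1" by (auto simp: power_less_one_iff)
  then have \<eta>: "0 < \<eta>" "\<eta> < 1" by (auto simp: \<eta>_def)
  \<comment> \<open>The first entry ensures that \<open>r\<^sup>2 * x\<close> examples are at least
    \<open>n0\<close>; the second bounds the variance term 1 / (\<eta>^2 x) by (c - c'') / sqrt
    x.\<close>
  define K where "K = max (real n0 / r\<^sup>2) ((1 / (\<eta>\<^sup>2 * (c - c'')))\<^sup>2)"
  have K: "0 < K" using n0 r2 by (auto simp: K_def less_max_iff_disj)
  have "b * measure_pmf.expectation (binomial_pmf m p) (\<lambda>N. measure_pmf.prob (V_pmf N b) {..0})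
      \<le> c / sqrt (real m * p)"
    if p: "0 < p" "p \<le> 1" and b: "0 \<le> b" "b \<le> 1" and mp: "K \<le> real m * p" for m p b
  proof -
    let ?E = "measure_pmf.expectation (binomial_pmf m p)"
    define x where "x = real m * p"
    have "0 < x" using K mp unfolding x_def by linarith
    moreover have "real n0 / r\<^sup>2 \<le> x" "(1 / (\<eta>\<^sup>2 * (c - c'')))\<^sup>2 \<le> x"
      using mp unfolding x_def[symmetric] K_def max.bounded_iff by blast+
    moreover have "real n0 \<le> r\<^sup>2 * x"
      using \<open>real n0 / r\<^sup>2 \<le> x\<close> r2(1) by (metis pos_divide_le_eq mult.commute)
    ultimately have x: "0 < x" "real n0 \<le> r\<^sup>2 * x" "(1 / (\<eta>\<^sup>2 * (c - c'')))\<^sup>2 \<le> x"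
      by blast+
    have p': "p \<in> {0..1}" using p by auto
    have pw: "b * measure_pmf.prob (V_pmf N b) {..0} \<le> (real N - x)\<^sup>2 / (\<eta> * x)\<^sup>2 + c'' / sqrt x" for N
    proof (cases "r\<^sup>2 * x \<le> real N")
      case True
      with x have "n0 \<le> N" by linarith
      then have "b * measure_pmf.prob (V_pmf N b) {..0} \<le> c' / sqrt (real N)"
        using b by (intro n0)
      also have "\<dots> \<le> c' / sqrt (r\<^sup>2 * x)"
        using True x r2 c by (intro frac_le) auto
      also have "\<dots> = c'' / sqrt x"
        using r c by (simp add: real_sqrt_mult r_def)
      also have "\<dots> \<le> (real N - x)\<^sup>2 / (\<eta> * x)\<^sup>2 + c'' / sqrt x" by simp
      finally show ?thesis .
    next
      \<comment> \<open>Here N deviates from its mean by at least the fraction \<eta>, so the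
        quadratic term alone is at least 1 and dominates any probability. Chebyshev's argument is
        thus carried out pointwise, before the expectation is taken.\<close>
      case False
      then have "\<eta> * x \<le> x - real N" by (simp add: \<eta>_def algebra_simps)
      then have "(\<eta> * x)\<^sup>2 \<le> (x - real N)\<^sup>2" using \<eta> x by (intro power_mono) auto
      then have "1 \<le> (real N - x)\<^sup>2 / (\<eta> * x)\<^sup>2"
        using \<eta> x by (simp add: power2_commute)
      moreover have "b * measure_pmf.prob (V_pmf N b) {..0} \<le> 1 * 1"
        using b by (intro mult_mono) auto
      moreover have "0 \<le> c'' / sqrt x" using c x by simp
      ultimately show ?thesis by linarith
    qed
    have "b * ?E (\<lambda>N. measure_pmf.prob (V_pmf N b) {..0}) = ?E (\<lambda>N. b * measure_pmf.prob (V_pmf N b) {..0})"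
      by simp
    also have "\<dots> \<le> ?E (\<lambda>N. (real N - x)\<^sup>2 / (\<eta> * x)\<^sup>2 + c'' / sqrt x)"
      by (intro integral_mono integrable_binomial_pmf p' pw)
    also have "\<dots> = x * (1 - p) / (\<eta> * x)\<^sup>2 + c'' / sqrt x"
      using p' variance_binomial[OF p', of m] by (simp add: integral_add x_def)
    also have "\<dots> \<le> x / (\<eta> * x)\<^sup>2 + c'' / sqrt x"
      using p x by (intro add_right_mono divide_right_mono) (auto simp: mult_left_le)
    also have "x / (\<eta> * x)\<^sup>2 = 1 / \<eta>\<^sup>2 / sqrt x / sqrt x"
    proof -
      have "sqrt x * sqrt x = x" using x by simp
      then show ?thesis using x by (simp add: power2_eq_square divide_divide_eq_left mult.assoc)
    qed
    also have "\<dots> \<le> (c - c'') / sqrt x"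
    proof (intro divide_right_mono)
      have "1 / (\<eta>\<^sup>2 * (c - c'')) \<le> sqrt x"
        using x(3) by (rule real_le_rsqrt)
      then show "1 / \<eta>\<^sup>2 / sqrt x \<le> c - c''"
        using c \<eta> x by (simp add: pos_divide_le_eq mult_ac)
    qed (use x in simp)
    finally show ?thesis by (simp add: x_def diff_divide_distrib)
  qed
  with K show ?thesis by blast
qed

section \<open>Reduction to testing\<close>

lemma finite_examples [simp]: "finite (examples d)"
  by (simp add: examples_def)

lemma finite_hypotheses [simp]: "finite (hypotheses d)"
  unfolding hypotheses_def by (rule finite_PiE) auto

lemma hypotheses_nonempty [simp]: "hypotheses d \<noteq> {}"
  unfolding hypotheses_def PiE_eq_empty_iff by simp

lemma hypotheses_range: "h \<in> hypotheses d \<Longrightarrow> x \<in> {1..d} \<Longrightarrow> h x \<in> {-1, 1}"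
  unfolding hypotheses_def by (rule PiE_mem)

lemma flip_hypotheses:
  assumes "\<sigma> \<in> hypotheses d" "x \<in> {1..d}"
  shows "\<sigma>(x := - \<sigma> x) \<in> hypotheses d"
proof -
  have "- \<sigma> x \<in> {-1, 1}" using hypotheses_range[OF assms] by auto
  with assms show ?thesis by (auto simp: hypotheses_def PiE_iff extensional_def)
qed

lemma finite_samples [simp]: "finite (samples m d)"
proof -
  have "samples m d = {z. set z \<subseteq> examples d \<and> length z = m}" by (auto simp: samples_def)
  then show ?thesis by (simp add: finite_lists_length_eq)
qed

lemma set_replicate_pmf_samples:
  "D \<in> distributions d \<Longrightarrow> set_pmf (replicate_pmf m D) \<subseteq> samples m d"
  by (auto simp: set_replicate_pmf samples_def distributions_def lists_eq_set)

lemma err_eq: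
  assumes "D \<in> distributions d" "h \<in> hypotheses d"
  shows "err h D = (\<Sum>x\<in>{1..d}. pmf D (x, - h x))"
proof -
  have D: "set_pmf D \<subseteq> examples d" using assms(1) by (simp add: distributions_def)
  have "err h D = measure_pmf.prob D ({(x, y). h x \<noteq> y} \<inter> set_pmf D)"
    by (simp add: err_def measure_Int_set_pmf)
  also have "{(x, y). h x \<noteq> y} \<inter> set_pmf D = (\<lambda>x. (x, - h x)) ` {1..d} \<inter> set_pmf D"
    using D hypotheses_range[OF assms(2)] by (fastforce simp: examples_def)
  also have "measure_pmf.prob D \<dots> = measure_pmf.prob D ((\<lambda>x. (x, - h x)) ` {1..d})"
    by (simp add: measure_Int_set_pmf)
  also have "\<dots> = (\<Sum>x\<in>{1..d}. pmf D (x, - h x))"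
    by (subst measure_measure_pmf_finite) (auto simp: sum.reindex inj_on_def)
  finally show ?thesis .
qed

text \<open>A hypothesis is free at every point, so the minimum is taken pointwise; at x the smaller
  of the two label masses is unavoidable.\<close>

lemma excess_eq:
  assumes D: "D \<in> distributions d" and h: "h \<in> hypotheses d"
  shows "excess d h D = (\<Sum>x\<in>{1..d}. max 0 (pmf D (x, - h x) - pmf D (x, h x)))"
proof -
  let ?m = "\<lambda>x. min (pmf D (x, 1)) (pmf D (x, - 1))"
  have "(MIN g\<in>hypotheses d. err g D) = (\<Sum>x\<in>{1..d}. ?m x)"
  proof (rule Min_eqI)
    fix e assume "e \<in> (\<lambda>g. err g D) ` hypotheses d"
    then obtain g where g: "g \<in> hypotheses d" "e = err g D" by auto
    show "(\<Sum>x\<in>{1..d}. ?m x) \<le> e"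
      unfolding g(2) err_eq[OF D g(1)]
    proof (rule sum_mono)
      fix x assume "x \<in> {1..d}"
      then show "?m x \<le> pmf D (x, - g x)" using hypotheses_range[OF g(1), of x] by auto
    qed
  next
    define g where "g = restrict (\<lambda>x. if pmf D (x, 1) \<le> pmf D (x, - 1) then - 1 else 1 :: int) {1..d}"
    have g: "g \<in> hypotheses d" by (auto simp: g_def hypotheses_def)
    have "err g D = (\<Sum>x\<in>{1..d}. ?m x)"
      unfolding err_eq[OF D g] by (rule sum.cong) (auto simp: g_def)
    with g show "(\<Sum>x\<in>{1..d}. ?m x) \<in> (\<lambda>g. err g D) ` hypotheses d" by (metis image_eqI)
  qed simp
  then have "excess d h D = (\<Sum>x\<in>{1..d}. pmf D (x, - h x) - ?m x)"
    by (simp add: excess_def err_eq[OF D h] sum_subtractf)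
  also have "\<dots> = (\<Sum>x\<in>{1..d}. max 0 (pmf D (x, - h x) - pmf D (x, h x)))"
  proof (rule sum.cong)
    fix x assume "x \<in> {1..d}"
    then show "pmf D (x, - h x) - ?m x = max 0 (pmf D (x, - h x) - pmf D (x, h x))"
      using hypotheses_range[OF h, of x] by auto
  qed simp
  finally show ?thesis .
qed

lemma excess_bounds:
  assumes "D \<in> distributions d" "h \<in> hypotheses d"
  shows "0 \<le> excess d h D" "excess d h D \<le> 1"
proof -
  show "0 \<le> excess d h D"
    unfolding excess_eq[OF assms] by (intro sum_nonneg) auto
  have "0 \<le> (MIN g\<in>hypotheses d. err g D)"
    by (simp add: err_def)
  moreover have "err h D \<le> 1" by (simp add: err_def)
  ultimately show "excess d h D \<le> 1" unfolding excess_def by linarith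
qed

lemma expectation_samples:
  fixes f :: "_ \<Rightarrow> real"
  assumes "D \<in> distributions d"
  shows "measure_pmf.expectation (replicate_pmf m D) f
    = (\<Sum>z\<in>samples m d. pmf (replicate_pmf m D) z * f z)"
  using set_replicate_pmf_samples[OF assms, of m]
  by (subst integral_measure_pmf[of "samples m d"]) auto

lemma integrable_samples:
  assumes "D \<in> distributions d"
  shows "integrable (measure_pmf (replicate_pmf m D)) (f :: _ \<Rightarrow> real)"
  by (intro integrable_measure_pmf_finite finite_subset[OF set_replicate_pmf_samples[OF assms]]) simp

lemma learnersD: "L \<in> learners m d \<Longrightarrow> z \<in> samples m d \<Longrightarrow> L z \<in> hypotheses d"
  by (auto simp: learners_def)

lemma risk_bounds:
  assumes "D \<in> distributions d" "L \<in> learners m d"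
  shows "0 \<le> risk m d L D" "risk m d L D \<le> 1"
proof -
  note b = excess_bounds[OF assms(1) learnersD[OF assms(2)]]
  have s: "AE z in measure_pmf (replicate_pmf m D). z \<in> samples m d"
    using set_replicate_pmf_samples[OF assms(1), of m] by (auto simp: AE_measure_pmf_iff)
  show "0 \<le> risk m d L D"
    unfolding risk_def using s by (intro integral_nonneg_AE) (auto elim!: eventually_mono intro: b)
  have "risk m d L D \<le> measure_pmf.expectation (replicate_pmf m D) (\<lambda>z. 1)"
    unfolding risk_def using s
    by (intro integral_mono_AE integrable_samples[OF assms(1)]) (auto elim!: eventually_mono intro: b)
  then show "risk m d L D \<le> 1" by simp
qed

section \<open>The votes at one point as a random walk\<close>

lemma pmf_Y_pmf:
  assumes "\<bar>b\<bar> \<le> 1"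
  shows "pmf (Y_pmf b) i = (if i = 1 then (1 + b) / 2 else if i = -1 then (1 - b) / 2 else 0)"
proof -
  let ?f = "\<lambda>t. if t then 1 else -1 :: int"
  have p: "0 \<le> (1 + b) / 2" "(1 + b) / 2 \<le> 1" using assms by auto
  have inj: "inj ?f" by (auto simp: inj_on_def)
  show ?thesis
  proof (cases "i = 1 \<or> i = -1")
    case True
    then show ?thesis
      using pmf_map_inj'[OF inj, of "bernoulli_pmf ((1 + b) / 2)" True]
        pmf_map_inj'[OF inj, of "bernoulli_pmf ((1 + b) / 2)" False] p
      by (auto simp: Y_pmf_def field_simps)
  next
    case False
    then have "i \<notin> set_pmf (Y_pmf b)" by (auto simp: Y_pmf_def)
    then show ?thesis using False by (simp add: set_pmf_iff)
  qed
qed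

text \<open>The sign \<open>\<tau>\<close> orients the labels at \<open>x\<close>: taken as the more
  likely label, it gives the walk of votes a nonnegative bias.\<close>

definition vote :: "int \<Rightarrow> nat \<Rightarrow> nat \<times> int \<Rightarrow> int" where
  "vote \<tau> x = (\<lambda>(x', y). if x' = x then \<tau> * y else 0)"

definition votes :: "int \<Rightarrow> nat \<Rightarrow> (nat \<times> int) list \<Rightarrow> int" where
  "votes \<tau> x z = sum_list (map (vote \<tau> x) z)"

lemma votes_minus: "votes (- \<tau>) x z = - votes \<tau> x z"
  by (induction z) (auto simp: votes_def vote_def)

lemma marginal_le_1:
  fixes D :: "(nat \<times> int) pmf"
  shows "pmf D (x, 1) + pmf D (x, - 1) \<le> 1"
proof -
  have "pmf D (x, 1) + pmf D (x, - 1) = measure_pmf.prob D {(x, 1), (x, - 1)}"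
    by (simp add: measure_pmf_insert measure_pmf_single)
  also have "\<dots> \<le> 1" by simp
  finally show ?thesis .
qed

text \<open>An example falls on \<open>x\<close> with probability \<open>p\<close> and then votes
  like \<open>Y_pmf b\<close>. The bias is specified by the product \<open>p * b\<close>, so that no
  division by the mass of \<open>x\<close> occurs.\<close>

lemma map_pmf_vote:
  assumes D: "D \<in> distributions d" and \<tau>: "\<tau> \<in> {-1, 1}" and b: "\<bar>b\<bar> \<le> 1"
    and p: "p = pmf D (x, 1) + pmf D (x, - 1)" and pb: "p * b = pmf D (x, \<tau>) - pmf D (x, - \<tau>)"
  shows "map_pmf (vote \<tau> x) D = bernoulli_pmf p \<bind> (\<lambda>t. if t then Y_pmf b else return_pmf 0)"
proof (rule pmf_eqI)
  fix i
  have D': "set_pmf D \<subseteq> examples d" using D by (simp add: distributions_def)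
  have p01: "0 \<le> p" "p \<le> 1" using marginal_le_1[of D x] by (simp_all add: p)
  have p': "p = pmf D (x, \<tau>) + pmf D (x, - \<tau>)" using \<tau> by (auto simp: p)
  have R: "pmf (bernoulli_pmf p \<bind> (\<lambda>t. if t then Y_pmf b else return_pmf 0)) i
      = p * pmf (Y_pmf b) i + (1 - p) * pmf (return_pmf 0) i"
    using p01 by (simp add: pmf_bind)
  have L: "pmf (map_pmf (vote \<tau> x) D) i = measure_pmf.prob D (vote \<tau> x -` {i} \<inter> set_pmf D)"
    by (simp add: pmf_map measure_Int_set_pmf)
  consider "i = 1" | "i = -1" | "i = 0" | "i \<notin> {-1, 0, 1}" by blast
  then show "pmf (map_pmf (vote \<tau> x) D) i = pmf (bernoulli_pmf p \<bind> (\<lambda>t. if t then Y_pmf b else return_pmf 0)) i"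
  proof cases
    case 1
    have "vote \<tau> x -` {i} \<inter> set_pmf D = {(x, \<tau>)} \<inter> set_pmf D"
      using D' \<tau> 1 by (auto simp: vote_def examples_def split: if_splits)
    then show ?thesis
      unfolding L R using 1 pb p' by (simp add: measure_Int_set_pmf measure_pmf_single pmf_Y_pmf[OF b] field_simps)
  next
    case 2
    have "vote \<tau> x -` {i} \<inter> set_pmf D = {(x, - \<tau>)} \<inter> set_pmf D"
      using D' \<tau> 2 by (auto simp: vote_def examples_def split: if_splits)
    then show ?thesis
      unfolding L R using 2 pb p' by (simp add: measure_Int_set_pmf measure_pmf_single pmf_Y_pmf[OF b] field_simps)
  next
    case 3
    have "vote \<tau> x -` {i} \<inter> set_pmf D = (UNIV - {(x, 1), (x, - 1)}) \<inter> set_pmf D"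
      using D' \<tau> 3 by (auto simp: vote_def examples_def split: if_splits)
    then have "measure_pmf.prob D (vote \<tau> x -` {i} \<inter> set_pmf D) = 1 - measure_pmf.prob D {(x, 1), (x, - 1)}"
      using measure_pmf.prob_compl[of "{(x, 1), (x, - 1)}" D] by (simp add: measure_Int_set_pmf)
    also have "measure_pmf.prob D {(x, 1), (x, - 1)} = p"
      by (simp add: p measure_pmf_insert measure_pmf_single)
    finally show ?thesis
      unfolding L R using 3 by (simp add: pmf_Y_pmf[OF b])
  next
    case 4
    have "vote \<tau> x -` {i} \<inter> set_pmf D = {}"
      using D' \<tau> 4 by (auto simp: vote_def examples_def split: if_splits)
    then show ?thesis
      unfolding L R using 4 by (simp add: pmf_Y_pmf[OF b] indicator_def)
  qed
qed

lemma map_replicate_pmf: "map_pmf (map f) (replicate_pmf m D) = replicate_pmf m (map_pmf f D)"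
proof (induction m)
  case (Suc m)
  show ?case by (simp add: map_bind_pmf bind_map_pmf flip: Suc)
qed simp

lemma sum_list_lazy_pmf:
  assumes "p \<in> {0..1}"
  shows "map_pmf sum_list (replicate_pmf m (bernoulli_pmf p \<bind> (\<lambda>t. if t then Y_pmf b else return_pmf 0)))
    = binomial_pmf m p \<bind> (\<lambda>N. V_pmf N b)"
proof (induction m)
  case 0
  show ?case by (simp add: binomial_pmf_0[OF assms] bind_return_pmf V_pmf_0)
next
  case (Suc m)
  let ?T = "bernoulli_pmf p \<bind> (\<lambda>t. if t then Y_pmf b else return_pmf 0)"
  have "map_pmf sum_list (replicate_pmf (Suc m) ?T)
      = ?T \<bind> (\<lambda>y. map_pmf (\<lambda>v. y + v) (map_pmf sum_list (replicate_pmf m ?T)))"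
    by (simp add: map_bind_pmf map_pmf_comp o_def map_pmf_def bind_assoc_pmf bind_return_pmf)
  also have "\<dots> = bernoulli_pmf p \<bind> (\<lambda>t. (if t then Y_pmf b else return_pmf 0)
      \<bind> (\<lambda>y. binomial_pmf m p \<bind> (\<lambda>N. map_pmf (\<lambda>v. y + v) (V_pmf N b))))"
    unfolding Suc by (simp add: map_bind_pmf bind_assoc_pmf)
  also have "\<dots> = bernoulli_pmf p \<bind> (\<lambda>t. binomial_pmf m p \<bind> (\<lambda>N. V_pmf ((if t then 1 else 0) + N) b))"
  proof (rule bind_pmf_cong[OF refl])
    fix t
    show "(if t then Y_pmf b else return_pmf 0) \<bind> (\<lambda>y. binomial_pmf m p \<bind> (\<lambda>N. map_pmf (\<lambda>v. y + v) (V_pmf N b)))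
        = binomial_pmf m p \<bind> (\<lambda>N. V_pmf ((if t then 1 else 0) + N) b)"
    \<comment> \<open>If the example falls on \<open>x\<close>, exchanging the draws of its vote and
      of the count N turns one vote plus N further steps into a walk of N + 1 steps.\<close>
    proof (cases t)
      case False
      have "(+) 0 = (id :: int \<Rightarrow> int)" by auto
      with False show ?thesis by (simp add: bind_return_pmf)
    qed (subst bind_commute_pmf, simp add: V_pmf_Suc)
  qed
  also have "\<dots> = binomial_pmf (Suc m) p \<bind> (\<lambda>N. V_pmf N b)"
    by (simp add: binomial_pmf_Suc[OF assms] bind_assoc_pmf bind_return_pmf)
  finally show ?case .
qed

lemma map_pmf_votes:
  assumes D: "D \<in> distributions d" and \<tau>: "\<tau> \<in> {-1, 1}" and b: "\<bar>b\<bar> \<le> 1"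
    and p: "p = pmf D (x, 1) + pmf D (x, - 1)" and pb: "p * b = pmf D (x, \<tau>) - pmf D (x, - \<tau>)"
  shows "map_pmf (votes \<tau> x) (replicate_pmf m D) = binomial_pmf m p \<bind> (\<lambda>N. V_pmf N b)"
proof -
  have "p \<in> {0..1}" using marginal_le_1[of D x] by (simp add: p)
  have "map_pmf (votes \<tau> x) (replicate_pmf m D)
      = map_pmf sum_list (map_pmf (map (vote \<tau> x)) (replicate_pmf m D))"
    by (simp add: map_pmf_comp votes_def[abs_def])
  then show ?thesis
    by (simp add: map_replicate_pmf map_pmf_vote[OF assms] sum_list_lazy_pmf[OF \<open>p \<in> {0..1}\<close>])
qed

lemma prob_votes:
  assumes D: "D \<in> distributions d" and \<tau>: "\<tau> \<in> {-1, 1}" and b: "\<bar>b\<bar> \<le> 1"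
    and p: "p = pmf D (x, 1) + pmf D (x, - 1)" and pb: "p * b = pmf D (x, \<tau>) - pmf D (x, - \<tau>)"
  shows "measure_pmf.prob (replicate_pmf m D) {z. votes \<tau> x z \<in> A}
    = measure_pmf.expectation (binomial_pmf m p) (\<lambda>N. measure_pmf.prob (V_pmf N b) A)"
proof -
  have "measure_pmf.prob (replicate_pmf m D) {z. votes \<tau> x z \<in> A}
      = measure_pmf.prob (map_pmf (votes \<tau> x) (replicate_pmf m D)) A"
    by (simp add: vimage_def)
  then show ?thesis by (simp add: map_pmf_votes[OF assms] measure_bind_pmf)
qed

section \<open>Hidden sign patterns and two-point testing\<close>

definition hard_pmf :: "nat \<Rightarrow> real \<Rightarrow> (nat \<Rightarrow> int) \<Rightarrow> (nat \<times> int) pmf" where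
  "hard_pmf d b \<sigma> = pmf_of_set {1..d} \<bind> (\<lambda>x. map_pmf (Pair x) (Y_pmf (b * of_int (\<sigma> x))))"

lemma hard_pmf_in_distributions:
  assumes "1 \<le> d"
  shows "hard_pmf d b \<sigma> \<in> distributions d"
  using assms by (auto simp: hard_pmf_def distributions_def examples_def Y_pmf_def split: if_splits)

lemma pmf_hard_pmf:
  assumes "1 \<le> d" "\<bar>b\<bar> \<le> 1" "\<sigma> \<in> hypotheses d" "x \<in> {1..d}" "y \<in> {-1, 1}"
  shows "pmf (hard_pmf d b \<sigma>) (x, y) = (1 + b * of_int (\<sigma> x * y)) / (2 * real d)"
proof -
  have "\<bar>b * of_int (\<sigma> x)\<bar> \<le> 1"
    using assms(2) hypotheses_range[OF assms(3,4)] by auto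
  then have Y: "pmf (Y_pmf (b * of_int (\<sigma> x))) y = (1 + b * of_int (\<sigma> x * y)) / 2"
    using assms(5) by (auto simp: pmf_Y_pmf)
  have P: "pmf (map_pmf (Pair x') p) (x, y) = (if x' = x then pmf p y else 0)" for x' and p :: "int pmf"
  proof (cases "x' = x")
    case True
    then show ?thesis using pmf_map_inj'[of "Pair x" p y] by (simp add: inj_on_def)
  next
    case False
    then show ?thesis by (auto simp: pmf_eq_0_set_pmf)
  qed
  have "pmf (hard_pmf d b \<sigma>) (x, y)
      = (\<Sum>x'\<in>{1..d}. if x' = x then pmf (Y_pmf (b * of_int (\<sigma> x'))) y else 0) / real d"
    unfolding hard_pmf_def using assms(1) by (subst pmf_bind_pmf_of_set) (auto simp: P)
  also have "\<dots> = pmf (Y_pmf (b * of_int (\<sigma> x))) y / real d"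
    using assms(4) by simp
  finally show ?thesis by (simp add: Y)
qed

lemma excess_hard_pmf:
  assumes "1 \<le> d" "0 \<le> b" "b \<le> 1" "\<sigma> \<in> hypotheses d" "h \<in> hypotheses d"
  shows "excess d h (hard_pmf d b \<sigma>) = (\<Sum>x\<in>{1..d}. b / real d * (if h x = \<sigma> x then 0 else 1))"
  unfolding excess_eq[OF hard_pmf_in_distributions[OF assms(1)] assms(5)]
proof (rule sum.cong)
  fix x assume x: "x \<in> {1..d}"
  have "pmf (hard_pmf d b \<sigma>) (x, h x) = (1 + b * of_int (\<sigma> x * h x)) / (2 * real d)"
    "pmf (hard_pmf d b \<sigma>) (x, - h x) = (1 + b * of_int (\<sigma> x * (- h x))) / (2 * real d)"
    using assms hypotheses_range[OF assms(5) x] x by (intro pmf_hard_pmf; auto)+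
  then have "pmf (hard_pmf d b \<sigma>) (x, - h x) - pmf (hard_pmf d b \<sigma>) (x, h x) = - (b / real d * of_int (\<sigma> x * h x))"
    using assms(1) by (simp add: field_simps)
  moreover have "0 \<le> b / real d" using assms by simp
  ultimately show "max 0 (pmf (hard_pmf d b \<sigma>) (x, - h x) - pmf (hard_pmf d b \<sigma>) (x, h x))
      = b / real d * (if h x = \<sigma> x then 0 else 1)"
    using hypotheses_range[OF assms(4) x] hypotheses_range[OF assms(5) x] by auto
qed simp

lemma pmf_replicate_Cons:
  "pmf (replicate_pmf (Suc m) D) (a # z) = pmf D a * pmf (replicate_pmf m D) z"
proof -
  have "replicate_pmf (Suc m) D = map_pmf (\<lambda>(a, z). a # z) (pair_pmf D (replicate_pmf m D))"
    by (simp add: pair_pmf_def map_bind_pmf bind_return_pmf map_pmf_def bind_assoc_pmf)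
  moreover have "pmf (map_pmf (\<lambda>(a, z). a # z) (pair_pmf D (replicate_pmf m D))) ((\<lambda>(a, z). a # z) (a, z))
      = pmf (pair_pmf D (replicate_pmf m D)) (a, z)"
    by (rule pmf_map_inj') (auto simp: inj_on_def)
  ultimately show ?thesis by (simp add: pmf_pair)
qed

text \<open>The likelihood ratio of the samples under \<open>\<sigma>\<close> and under \<open>\<sigma>\<close> flipped at \<open>x\<close>
  is a function of the votes at \<open>x\<close>.\<close>

lemma likelihood_ratio:
  assumes d: "1 \<le> d" and b: "0 \<le> b" "b \<le> 1" and \<sigma>: "\<sigma> \<in> hypotheses d" and x: "x \<in> {1..d}"
    and z: "z \<in> samples m d"
  shows "\<exists>c\<ge>0. \<exists>k l. pmf (replicate_pmf m (hard_pmf d b \<sigma>)) z = c * (1 + b) ^ k * (1 - b) ^ l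
    \<and> pmf (replicate_pmf m (hard_pmf d b (\<sigma>(x := - \<sigma> x)))) z = c * (1 + b) ^ l * (1 - b) ^ k
    \<and> votes (\<sigma> x) x z = int k - int l"
  using z
proof (induction z arbitrary: m)
  case Nil
  then show ?case
    by (intro exI[of _ 1] exI[of _ 0] conjI) (auto simp: samples_def votes_def)
next
  case (Cons a z)
  obtain x' y where a: "a = (x', y)" by (cases a)
  from Cons.prems obtain n where m: "m = Suc n" and z: "z \<in> samples n d"
    and x': "x' \<in> {1..d}" and y: "y \<in> {-1, 1}"
    by (auto simp: samples_def examples_def a)
  obtain c k l where c: "0 \<le> c" and
    IH: "pmf (replicate_pmf n (hard_pmf d b \<sigma>)) z = c * (1 + b) ^ k * (1 - b) ^ l"
      "pmf (replicate_pmf n (hard_pmf d b (\<sigma>(x := - \<sigma> x)))) z = c * (1 + b) ^ l * (1 - b) ^ k"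
      "votes (\<sigma> x) x z = int k - int l"
    using Cons.IH[OF z] by blast
  have \<sigma>x: "\<sigma> x \<in> {-1, 1}" by (rule hypotheses_range[OF \<sigma> x])
  have flip: "\<sigma>(x := - \<sigma> x) \<in> hypotheses d"
    by (rule flip_hypotheses[OF \<sigma> x])
  have b': "\<bar>b\<bar> \<le> 1" using b by simp
  note pm = pmf_hard_pmf[OF d b' \<sigma> x' y] pmf_hard_pmf[OF d b' flip x' y]
  have v: "votes (\<sigma> x) x (a # z) = (if x' = x then \<sigma> x * y else 0) + (int k - int l)"
    by (simp add: votes_def vote_def a flip: IH(3))
  \<comment> \<open>\<open>k\<close> and \<open>l\<close> count the labels at \<open>x\<close> that
    agree and disagree with \<open>\<sigma> x\<close>. An example elsewhere has the same probability
    under both patterns and goes into the common factor \<open>c\<close>.\<close>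
  consider "x' \<noteq> x" | "x' = x" "\<sigma> x * y = 1" | "x' = x" "\<sigma> x * y = - 1"
    using \<sigma>x y by (cases "x' = x") auto
  then show ?case
  proof cases
    case 1
    define q where "q = (1 + b * of_int (\<sigma> x' * y)) / (2 * real d)"
    have "0 \<le> q" using pm(1) pmf_nonneg unfolding q_def by metis
    moreover have "pmf (hard_pmf d b (\<sigma>(x := - \<sigma> x))) (x', y) = q"
      using pm(2) 1 by (simp add: q_def)
    ultimately show ?thesis
      unfolding m v[unfolded a] a pmf_replicate_Cons IH pm(1) q_def[symmetric] using 1 c
      by - (rule exI[of _ "q * c"], rule conjI, simp, rule exI[of _ k], rule exI[of _ l], simp add: mult.assoc)
  next
    case 2
    then show ?thesis
      unfolding m v[unfolded a] a pmf_replicate_Cons IH pm using c d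
      by - (rule exI[of _ "c / (2 * real d)"], rule conjI, simp, rule exI[of _ "Suc k"], rule exI[of _ l],
          auto simp: field_simps)
  next
    case 3
    then show ?thesis
      unfolding m v[unfolded a] a pmf_replicate_Cons IH pm using c d
      by - (rule exI[of _ "c / (2 * real d)"], rule conjI, simp, rule exI[of _ k], rule exI[of _ "Suc l"],
          auto simp: field_simps)
  qed
qed

text \<open>After the common factors are split off, (1 - b)^n is compared with (1 + b)^n. Nothing is
  divided, so \<open>b = 1\<close> is covered.\<close>

lemma likelihood_order:
  assumes "1 \<le> d" "0 \<le> b" "b \<le> 1" "\<sigma> \<in> hypotheses d" "x \<in> {1..d}" "z \<in> samples m d"
  defines "P \<equiv> pmf (replicate_pmf m (hard_pmf d b \<sigma>)) z"
    and "Q \<equiv> pmf (replicate_pmf m (hard_pmf d b (\<sigma>(x := - \<sigma> x)))) z"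
  shows "votes (\<sigma> x) x z \<le> 0 \<Longrightarrow> P \<le> Q" "0 \<le> votes (\<sigma> x) x z \<Longrightarrow> Q \<le> P"
proof -
  obtain c k l where c: "0 \<le> c" and e: "P = c * (1 + b) ^ k * (1 - b) ^ l" "Q = c * (1 + b) ^ l * (1 - b) ^ k"
    "votes (\<sigma> x) x z = int k - int l"
    using likelihood_ratio[OF assms(1-6)] unfolding P_def Q_def by blast
  have swap: "c * (1 + b) ^ i * (1 - b) ^ j \<le> c * (1 + b) ^ j * (1 - b) ^ i" if ij: "i \<le> j" for i j :: nat
  proof -
    obtain n where j: "j = i + n" using ij le_Suc_ex by blast
    have "c * (1 + b) ^ i * (1 - b) ^ i * (1 - b) ^ n \<le> c * (1 + b) ^ i * (1 - b) ^ i * (1 + b) ^ n"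
      using assms(2,3) c by (intro mult_left_mono power_mono mult_nonneg_nonneg) auto
    then show ?thesis by (simp add: j power_add mult_ac)
  qed
  show "P \<le> Q" if "votes (\<sigma> x) x z \<le> 0" using that swap[of k l] unfolding e by simp
  show "Q \<le> P" if "0 \<le> votes (\<sigma> x) x z" using that swap[of l k] unfolding e by simp
qed

text \<open>The two-point testing bound of Le Cam, where the likelihood ratio test is optimal.\<close>

lemma two_point_bound:
  assumes d: "1 \<le> d" and b: "0 \<le> b" "b \<le> 1" and \<sigma>: "\<sigma> \<in> hypotheses d" and x: "x \<in> {1..d}"
    and L: "L \<in> learners m d"
  shows "2 * measure_pmf.expectation (binomial_pmf m (1 / real d)) (\<lambda>N. bayes N b)
    \<le> measure_pmf.expectation (replicate_pmf m (hard_pmf d b \<sigma>)) (\<lambda>z. if L z x = \<sigma> x then 0 else 1)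
      + measure_pmf.expectation (replicate_pmf m (hard_pmf d b (\<sigma>(x := - \<sigma> x))))
          (\<lambda>z. if L z x = (\<sigma>(x := - \<sigma> x)) x then 0 else 1)"
proof -
  let ?\<sigma> = "\<sigma>(x := - \<sigma> x)"
  let ?D = "hard_pmf d b \<sigma>" and ?D' = "hard_pmf d b ?\<sigma>"
  let ?P = "\<lambda>z. pmf (replicate_pmf m ?D) z" and ?Q = "\<lambda>z. pmf (replicate_pmf m ?D') z"
  have \<sigma>x: "\<sigma> x \<in> {-1, 1}" by (rule hypotheses_range[OF \<sigma> x])
  have flip: "?\<sigma> \<in> hypotheses d"
    by (rule flip_hypotheses[OF \<sigma> x])
  note D = hard_pmf_in_distributions[OF d, of b \<sigma>] and D' = hard_pmf_in_distributions[OF d, of b ?\<sigma>]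
  have b': "\<bar>b\<bar> \<le> 1" using b by simp
  have p: "1 / real d \<in> {0..1}" using d by simp
  let ?v = "votes (\<sigma> x) x"
  \<comment> \<open>Oriented by the true sign at \<open>x\<close>, the votes have the same law under
    every pattern, in particular under both of the competing ones.\<close>
  have law: "measure_pmf.prob (replicate_pmf m (hard_pmf d b \<rho>)) {z. votes (\<rho> x) x z \<in> A}
      = measure_pmf.expectation (binomial_pmf m (1 / real d)) (\<lambda>N. measure_pmf.prob (V_pmf N b) A)"
    if \<rho>: "\<rho> \<in> hypotheses d" for \<rho> A
  proof (rule prob_votes[OF hard_pmf_in_distributions[OF d] hypotheses_range[OF \<rho> x] b'])
    have \<rho>x: "\<rho> x \<in> {-1, 1}" by (rule hypotheses_range[OF \<rho> x])
    then have m\<rho>: "- \<rho> x \<in> {-1, 1}" by auto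
    note pm = pmf_hard_pmf[OF d b' \<rho> x]
    show "1 / real d = pmf (hard_pmf d b \<rho>) (x, 1) + pmf (hard_pmf d b \<rho>) (x, - 1)"
      using d by (simp add: pm field_simps)
    show "1 / real d * b = pmf (hard_pmf d b \<rho>) (x, \<rho> x) - pmf (hard_pmf d b \<rho>) (x, - \<rho> x)"
      using d \<rho>x unfolding pm[OF \<rho>x] pm[OF m\<rho>] by (auto simp: field_simps)
  qed
  \<comment> \<open>The likelihood ratio test gives ties to \<open>\<sigma>\<close>. Its errors are
    then P(V < 0) under \<open>\<sigma>\<close> and P(V \<le> 0) under the flipped pattern, with sum
    twice the Bayes error.\<close>
  have "measure_pmf.expectation (replicate_pmf m ?D) (\<lambda>z. if ?v z < 0 then 1 else 0)
      = measure_pmf.prob (replicate_pmf m ?D) {z. ?v z \<in> {..<0}}"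
  proof -
    have "(\<lambda>z. if ?v z < 0 then 1 else 0) = indicat_real {z. ?v z \<in> {..<0}}"
      by (auto simp: indicator_def fun_eq_iff)
    then show ?thesis by simp
  qed
  also note law[OF \<sigma>]
  finally have 1: "measure_pmf.expectation (replicate_pmf m ?D) (\<lambda>z. if ?v z < 0 then 1 else 0)
    = measure_pmf.expectation (binomial_pmf m (1 / real d)) (\<lambda>N. measure_pmf.prob (V_pmf N b) {..<0})" .
  have "measure_pmf.expectation (replicate_pmf m ?D') (\<lambda>z. if ?v z < 0 then 0 else 1)
      = measure_pmf.prob (replicate_pmf m ?D') {z. votes (?\<sigma> x) x z \<in> {..0}}"
  proof -
    have "(\<lambda>z. if ?v z < 0 then 0 else 1) = indicat_real {z. votes (?\<sigma> x) x z \<in> {..0}}"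
      by (auto simp: indicator_def fun_eq_iff votes_minus)
    then show ?thesis by simp
  qed
  also note law[OF flip]
  finally have 2: "measure_pmf.expectation (replicate_pmf m ?D') (\<lambda>z. if ?v z < 0 then 0 else 1)
    = measure_pmf.expectation (binomial_pmf m (1 / real d)) (\<lambda>N. measure_pmf.prob (V_pmf N b) {..0})" .
  have "2 * measure_pmf.expectation (binomial_pmf m (1 / real d)) (\<lambda>N. bayes N b)
      = measure_pmf.expectation (binomial_pmf m (1 / real d)) (\<lambda>N. measure_pmf.prob (V_pmf N b) {..<0})
      + measure_pmf.expectation (binomial_pmf m (1 / real d)) (\<lambda>N. measure_pmf.prob (V_pmf N b) {..0})"
  proof -
    have "measure_pmf.prob (V_pmf N b) {..<0} + measure_pmf.prob (V_pmf N b) {..0} = 2 * bayes N b" for N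
      by (simp add: prob_V_pmf_nonpos[OF b])
    then show ?thesis
      using p by (simp flip: Bochner_Integration.integral_add)
  qed
  also have "\<dots> = (\<Sum>z\<in>samples m d. ?P z * (if ?v z < 0 then 1 else 0) + ?Q z * (if ?v z < 0 then 0 else 1))"
    unfolding 1[symmetric] 2[symmetric] expectation_samples[OF D] expectation_samples[OF D']
    by (simp add: sum.distrib)
  also have "\<dots> \<le> (\<Sum>z\<in>samples m d. ?P z * (if L z x = \<sigma> x then 0 else 1) + ?Q z * (if L z x = ?\<sigma> x then 0 else 1))"
  \<comment> \<open>On each sample every algorithm errs under exactly one of the two patterns; the
    test errs under the one of smaller likelihood.\<close>
  proof (rule sum_mono)
    fix z assume z: "z \<in> samples m d"
    have "L z x = \<sigma> x \<or> L z x = ?\<sigma> x"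
      using hypotheses_range[OF learnersD[OF L z] x] \<sigma>x by auto
    then show "?P z * (if ?v z < 0 then 1 else 0) + ?Q z * (if ?v z < 0 then 0 else 1)
        \<le> ?P z * (if L z x = \<sigma> x then 0 else 1) + ?Q z * (if L z x = ?\<sigma> x then 0 else 1)"
      using likelihood_order[OF d b \<sigma> x z] \<sigma>x by (auto simp: not_less)
  qed
  also have "\<dots> = measure_pmf.expectation (replicate_pmf m ?D) (\<lambda>z. if L z x = \<sigma> x then 0 else 1)
      + measure_pmf.expectation (replicate_pmf m ?D') (\<lambda>z. if L z x = ?\<sigma> x then 0 else 1)"
    unfolding expectation_samples[OF D] expectation_samples[OF D'] by (simp add: sum.distrib)
  finally show ?thesis .
qed

text \<open>Stated for the sum over all patterns and not for one bad pattern, since a bad pattern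
  depends on the algorithm, while the sum can be integrated over the seed.\<close>

lemma average_risk_ge:
  assumes d: "1 \<le> d" and b: "0 \<le> b" "b \<le> 1" and L: "L \<in> learners m d"
  shows "real (card (hypotheses d)) * (b * measure_pmf.expectation (binomial_pmf m (1 / real d)) (\<lambda>N. bayes N b))
    \<le> (\<Sum>\<sigma>\<in>hypotheses d. risk m d L (hard_pmf d b \<sigma>))"
proof -
  let ?\<beta> = "measure_pmf.expectation (binomial_pmf m (1 / real d)) (\<lambda>N. bayes N b)"
  let ?e = "\<lambda>x \<sigma>. measure_pmf.expectation (replicate_pmf m (hard_pmf d b \<sigma>)) (\<lambda>z. if L z x = \<sigma> x then 0 else 1 :: real)"
  have err: "real (card (hypotheses d)) * ?\<beta> \<le> (\<Sum>\<sigma>\<in>hypotheses d. ?e x \<sigma>)" if x: "x \<in> {1..d}" for x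
  proof -
    let ?f = "\<lambda>\<sigma>. \<sigma>(x := - \<sigma> x)"
    \<comment> \<open>Flipping at \<open>x\<close> is an involution, so adding the two-point bounds
      over all patterns counts every error twice.\<close>
    have "bij_betw ?f (hypotheses d) (hypotheses d)"
    proof (rule bij_betw_byWitness[where f' = ?f])
      show "?f ` hypotheses d \<subseteq> hypotheses d" "?f ` hypotheses d \<subseteq> hypotheses d"
        using flip_hypotheses[OF _ x] by auto
    qed auto
    then have swap: "(\<Sum>\<sigma>\<in>hypotheses d. ?e x (?f \<sigma>)) = (\<Sum>\<sigma>\<in>hypotheses d. ?e x \<sigma>)"
      by (rule sum.reindex_bij_betw)
    have "2 * (real (card (hypotheses d)) * ?\<beta>) = (\<Sum>\<sigma>\<in>hypotheses d. 2 * ?\<beta>)" by simp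
    also have "\<dots> \<le> (\<Sum>\<sigma>\<in>hypotheses d. ?e x \<sigma> + ?e x (?f \<sigma>))"
      by (intro sum_mono two_point_bound d b x L)
    also have "\<dots> = 2 * (\<Sum>\<sigma>\<in>hypotheses d. ?e x \<sigma>)"
      unfolding sum.distrib swap by simp
    finally show ?thesis by simp
  qed
  have risk: "risk m d L (hard_pmf d b \<sigma>) = (\<Sum>x\<in>{1..d}. b / real d * ?e x \<sigma>)"
    if \<sigma>: "\<sigma> \<in> hypotheses d" for \<sigma>
  proof -
    note D = hard_pmf_in_distributions[OF d, of b \<sigma>]
    have "risk m d L (hard_pmf d b \<sigma>)
        = (\<Sum>z\<in>samples m d. pmf (replicate_pmf m (hard_pmf d b \<sigma>)) z
            * (\<Sum>x\<in>{1..d}. b / real d * (if L z x = \<sigma> x then 0 else 1)))"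
      unfolding risk_def expectation_samples[OF D]
      by (intro sum.cong refl) (simp add: excess_hard_pmf[OF d b \<sigma> learnersD[OF L]])
    also have "\<dots> = (\<Sum>x\<in>{1..d}. b / real d * ?e x \<sigma>)"
      unfolding expectation_samples[OF D] sum_distrib_left
      by (subst sum.swap) (intro sum.cong refl, simp add: mult_ac)
    finally show ?thesis .
  qed
  have "real (card (hypotheses d)) * (b * ?\<beta>) = (\<Sum>x\<in>{1..d}. b / real d * (real (card (hypotheses d)) * ?\<beta>))"
    using d by simp
  also have "\<dots> \<le> (\<Sum>x\<in>{1..d}. b / real d * (\<Sum>\<sigma>\<in>hypotheses d. ?e x \<sigma>))"
    using b by (intro sum_mono mult_left_mono err) auto
  also have "\<dots> = (\<Sum>\<sigma>\<in>hypotheses d. risk m d L (hard_pmf d b \<sigma>))"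
    by (subst sum.cong[OF refl risk]) (auto simp: sum_distrib_left intro: sum.swap)
  finally show ?thesis .
qed

section \<open>Minimax bounds\<close>

lemma distributions_nonempty: "1 \<le> d \<Longrightarrow> distributions d \<noteq> {}"
  using hard_pmf_in_distributions[of d] by blast

lemma learners_nonempty: "learners m d \<noteq> {}"
  using hypotheses_nonempty[of d] by (auto simp: learners_def)

text \<open>A supremum dominates an average. The class of algorithms and its risk are abstract, so
  one argument serves both minimax values; the bound by 1 keeps the real supremum
  meaningful.\<close>

lemma B0_le_minimax_if:
  assumes d: "1 \<le> d" and \<L>: "\<L> \<noteq> {}"
    and bdd: "\<And>L D. L \<in> \<L> \<Longrightarrow> D \<in> distributions d \<Longrightarrow> r L D \<le> (1 :: real)"
    and avg: "\<And>L b. L \<in> \<L> \<Longrightarrow> 0 \<le> b \<Longrightarrow> b \<le> 1 \<Longrightarrow>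
      real (card (hypotheses d)) * (b * measure_pmf.expectation (binomial_pmf m (1 / real d)) (\<lambda>N. bayes N b))
        \<le> (\<Sum>\<sigma>\<in>hypotheses d. r L (hard_pmf d b \<sigma>))"
  shows "B0 m d \<le> (INF L\<in>\<L>. SUP D\<in>distributions d. r L D)"
proof (rule cINF_greatest[OF \<L>])
  fix L assume L: "L \<in> \<L>"
  show "B0 m d \<le> (SUP D\<in>distributions d. r L D)"
    unfolding B0_def
  proof (rule cSUP_least)
    fix b :: real assume b: "b \<in> {0..1}"
    let ?\<beta> = "b * measure_pmf.expectation (binomial_pmf m (1 / real d)) (\<lambda>N. bayes N b)"
    have "real (card (hypotheses d)) * ?\<beta> \<le> (\<Sum>\<sigma>\<in>hypotheses d. r L (hard_pmf d b \<sigma>))"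
      using b by (intro avg L) auto
    also have "\<dots> \<le> (\<Sum>\<sigma>\<in>hypotheses d. SUP D\<in>distributions d. r L D)"
      by (intro sum_mono cSUP_upper hard_pmf_in_distributions d bdd_aboveI2[of _ _ 1] bdd L)
    also have "\<dots> = real (card (hypotheses d)) * (SUP D\<in>distributions d. r L D)" by simp
    finally show "?\<beta> \<le> (SUP D\<in>distributions d. r L D)"
      by (simp add: card_gt_0_iff)
  qed simp
qed

lemma B0_le_minimax: "1 \<le> d \<Longrightarrow> B0 m d \<le> minimax m d"
  unfolding minimax_def
  by (intro B0_le_minimax_if learners_nonempty risk_bounds average_risk_ge)

section \<open>Randomized algorithms\<close>

lemma prob_space_unif_sym: "prob_space unif_sym"
  unfolding unif_sym_def
  by (rule prob_space_uniform_measure) (auto simp: emeasure_restrict_space)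

lemma space_unif_sym [simp]: "space unif_sym = {-1..1}"
  by (simp add: unif_sym_def space_restrict_space)

lemma measure_unif_sym: "measure unif_sym {-1..1} = 1"
  using prob_space.prob_space[OF prob_space_unif_sym] by simp

lemma rand_learners_learners:
  "L \<in> rand_learners m d \<Longrightarrow> u \<in> {-1..1} \<Longrightarrow> (\<lambda>z. L z u) \<in> learners m d"
  by (auto simp: rand_learners_def learners_def dest!: bspec dest: measurable_space)

text \<open>Fubini's theorem: given the seed, a randomized algorithm is a deterministic one.\<close>

lemma risk_rand_eq:
  assumes D: "D \<in> distributions d" and L: "L \<in> rand_learners m d"
  shows "risk_rand m d L D = (\<integral>u. risk m d (\<lambda>z. L z u) D \<partial>unif_sym)"
    and "integrable unif_sym (\<lambda>u. risk m d (\<lambda>z. L z u) D)"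
proof -
  let ?R = "replicate_pmf m D"
  let ?M = "restrict_space (measure_pmf ?R) (samples m d)"
  let ?f = "\<lambda>z u. excess d (L z u) D"
  interpret U: prob_space unif_sym by (rule prob_space_unif_sym)
  have supp: "AE z in measure_pmf ?R. z \<in> samples m d"
    using set_replicate_pmf_samples[OF D, of m] by (auto simp: AE_measure_pmf_iff)
  interpret M: prob_space ?M
    by (rule prob_space_restrict_space) (use supp in \<open>simp_all add: measure_pmf.emeasure_eq_1_AE\<close>)
  interpret P: pair_prob_space ?M unif_sym ..
  have setsM: "sets ?M = sets (count_space (samples m d))"
    by (auto simp: sets_restrict_space)
  have meas: "(\<lambda>u. ?f z u) \<in> borel_measurable unif_sym" if "z \<in> samples m d" for z
  proof -
    have "L z \<in> measurable unif_sym (count_space (hypotheses d))"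
      using L that by (auto simp: rand_learners_def)
    then show ?thesis by (rule measurable_compose) simp
  qed
  \<comment> \<open>There are finitely many samples, so measurability in \<open>u\<close> for each
    of them yields joint measurability.\<close>
  have "(\<lambda>(z, u). ?f z u) \<in> borel_measurable (count_space (samples m d) \<Otimes>\<^sub>M unif_sym)"
    by (intro measurable_pair_measure_countable1 countable_finite) (auto intro: meas)
  then have m: "(\<lambda>(z, u). ?f z u) \<in> borel_measurable (?M \<Otimes>\<^sub>M unif_sym)"
    by (subst measurable_cong_sets[OF sets_pair_measure_cong[OF setsM refl] refl])
  have int: "integrable (?M \<Otimes>\<^sub>M unif_sym) (\<lambda>(z, u). ?f z u)"
  proof (rule P.integrable_const_bound[of _ 1, OF AE_I2 m])
    fix w assume "w \<in> space (?M \<Otimes>\<^sub>M unif_sym)"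
    then have "fst w \<in> samples m d" "snd w \<in> {-1..1}"
      by (auto simp: space_pair_measure space_restrict_space)
    then have "L (fst w) (snd w) \<in> hypotheses d"
      using learnersD[OF rand_learners_learners[OF L]] by blast
    from excess_bounds[OF D this] show "norm (case w of (z, u) \<Rightarrow> ?f z u) \<le> 1"
      by (simp add: case_prod_beta)
  qed
  have inner: "(\<integral>z. ?f z u \<partial>?M) = risk m d (\<lambda>z. L z u) D" for u
  proof -
    have "(\<integral>z. ?f z u \<partial>?M) = (\<integral>z. indicator (samples m d) z *\<^sub>R ?f z u \<partial>measure_pmf ?R)"
      by (rule integral_restrict_space) simp
    also have "\<dots> = risk m d (\<lambda>z. L z u) D"
      unfolding risk_def using supp
      by (intro integral_cong_AE) (auto elim!: eventually_mono)
    finally show ?thesis .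
  qed
  show "risk_rand m d L D = (\<integral>u. risk m d (\<lambda>z. L z u) D \<partial>unif_sym)"
    unfolding risk_rand_def inner[symmetric] by (rule P.integral_snd[OF int, symmetric])
  show "integrable unif_sym (\<lambda>u. risk m d (\<lambda>z. L z u) D)"
    unfolding inner[symmetric] by (rule P.integrable_snd[OF int])
qed

lemma risk_rand_bounds:
  assumes D: "D \<in> distributions d" and L: "L \<in> rand_learners m d"
  shows "0 \<le> risk_rand m d L D" "risk_rand m d L D \<le> 1"
proof -
  interpret U: prob_space unif_sym by (rule prob_space_unif_sym)
  note b = risk_bounds[OF D rand_learners_learners[OF L]]
  show "0 \<le> risk_rand m d L D"
    unfolding risk_rand_eq(1)[OF D L] by (intro integral_nonneg_AE AE_I2) (auto intro: b)
  have "risk_rand m d L D \<le> (\<integral>u. 1 \<partial>unif_sym)"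
    unfolding risk_rand_eq(1)[OF D L]
    by (intro integral_mono risk_rand_eq(2)[OF D L]) (auto intro: b)
  then show "risk_rand m d L D \<le> 1" by (simp add: measure_unif_sym)
qed

lemma const_rand_learner:
  assumes "L \<in> learners m d"
  shows "(\<lambda>z u. L z) \<in> rand_learners m d"
  using assms by (auto simp: rand_learners_def learnersD)

lemma rand_learners_nonempty: "rand_learners m d \<noteq> {}"
  using const_rand_learner learners_nonempty by blast

lemma risk_rand_const:
  assumes "D \<in> distributions d" "L \<in> learners m d"
  shows "risk_rand m d (\<lambda>z u. L z) D = risk m d L D"
proof -
  interpret U: prob_space unif_sym by (rule prob_space_unif_sym)
  show ?thesis
    by (simp add: risk_rand_eq(1)[OF assms(1) const_rand_learner[OF assms(2)]] measure_unif_sym)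
qed

lemma average_risk_rand_ge:
  assumes d: "1 \<le> d" and b: "0 \<le> b" "b \<le> 1" and L: "L \<in> rand_learners m d"
  shows "real (card (hypotheses d)) * (b * measure_pmf.expectation (binomial_pmf m (1 / real d)) (\<lambda>N. bayes N b))
    \<le> (\<Sum>\<sigma>\<in>hypotheses d. risk_rand m d L (hard_pmf d b \<sigma>))" (is "?c \<le> _")
proof -
  interpret U: prob_space unif_sym by (rule prob_space_unif_sym)
  note D = hard_pmf_in_distributions[OF d]
  have "?c = (\<integral>u. ?c \<partial>unif_sym)" by (simp add: measure_unif_sym)
  also have "\<dots> \<le> (\<integral>u. (\<Sum>\<sigma>\<in>hypotheses d. risk m d (\<lambda>z. L z u) (hard_pmf d b \<sigma>)) \<partial>unif_sym)"
    by (intro integral_mono Bochner_Integration.integrable_sum risk_rand_eq(2)[OF D L] average_risk_ge d b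
        rand_learners_learners[OF L]) auto
  also have "\<dots> = (\<Sum>\<sigma>\<in>hypotheses d. risk_rand m d L (hard_pmf d b \<sigma>))"
    by (subst Bochner_Integration.integral_sum) (auto intro: risk_rand_eq(2)[OF D L] simp: risk_rand_eq(1)[OF D L])
  finally show ?thesis .
qed

lemma B0_le_minimax_rand: "1 \<le> d \<Longrightarrow> B0 m d \<le> minimax_rand m d"
  unfolding minimax_rand_def
  by (intro B0_le_minimax_if rand_learners_nonempty risk_rand_bounds average_risk_rand_ge)

section \<open>The upper bound by majority votes\<close>

definition majority :: "nat \<Rightarrow> (nat \<times> int) list \<Rightarrow> nat \<Rightarrow> int" where
  "majority d z = restrict (\<lambda>x. if 0 < votes 1 x z then 1 else -1) {1..d}"

lemma majority_learner: "majority d \<in> learners m d"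
  by (auto simp: majority_def learners_def hypotheses_def)

lemma sum_marginals:
  assumes "D \<in> distributions d"
  shows "(\<Sum>x\<in>{1..d}. pmf D (x, 1) + pmf D (x, - 1)) = 1"
proof -
  have "1 = (\<Sum>a\<in>examples d. pmf D a)"
    using assms by (subst sum_pmf_eq_1) (auto simp: distributions_def)
  also have "\<dots> = (\<Sum>x\<in>{1..d}. \<Sum>y\<in>{-1, 1}. pmf D (x, y))"
    unfolding examples_def by (subst sum.cartesian_product) simp
  finally show ?thesis by (simp add: add.commute)
qed

lemma risk_majority_le:
  assumes "c_infty < c"
  shows "\<exists>K>0. \<forall>m d D. 1 \<le> m \<longrightarrow> 1 \<le> d \<longrightarrow> D \<in> distributions d \<longrightarrow>
    risk m d (majority d) D \<le> c / sqrt (real m / real d) + K / (real m / real d)"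
proof -
  have c0: "0 < c" using assms c_infty_pos by simp
  obtain K where K: "0 < K" and bound: "\<And>m p b. 0 < p \<Longrightarrow> p \<le> 1 \<Longrightarrow> 0 \<le> b \<Longrightarrow> b \<le> 1 \<Longrightarrow> K \<le> real m * p \<Longrightarrow>
    b * measure_pmf.expectation (binomial_pmf m p) (\<lambda>N. measure_pmf.prob (V_pmf N b) {..0}) \<le> c / sqrt (real m * p)"
    using expected_bias_prob_nonpos_le[OF assms] by metis
  have "risk m d (majority d) D \<le> c / sqrt (real m / real d) + K / (real m / real d)"
    if m: "1 \<le> m" and d: "1 \<le> d" and D: "D \<in> distributions d" for m d D
  proof -
    let ?R = "replicate_pmf m D"
    define p where "p x = pmf D (x, 1) + pmf D (x, - 1)" for x
    have p0: "0 \<le> p x" "p x \<le> 1" for x using marginal_le_1[of D x] by (simp_all add: p_def)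
    let ?g = "\<lambda>x z. max 0 (pmf D (x, - majority d z x) - pmf D (x, majority d z x))"
    have coord: "measure_pmf.expectation ?R (?g x) \<le> c / sqrt (real m) * sqrt (p x) + K / real m"
      if x: "x \<in> {1..d}" for x
    proof (cases "p x = 0")
      case True
      then have "pmf D (x, 1) = 0" "pmf D (x, - 1) = 0"
        unfolding p_def by (simp_all add: add_nonneg_eq_0_iff)
      then have "?g x z = 0" for z using x by (simp add: majority_def)
      then show ?thesis using K c0 p0 by simp
    next
      case False
      then have px: "0 < p x" using p0[of x] by simp
      define \<tau> :: int where "\<tau> = (if pmf D (x, - 1) \<le> pmf D (x, 1) then 1 else - 1)"
      define b where "b = (pmf D (x, \<tau>) - pmf D (x, - \<tau>)) / p x"
      have \<tau>: "\<tau> \<in> {-1, 1}" by (simp add: \<tau>_def)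
      have pb: "p x * b = pmf D (x, \<tau>) - pmf D (x, - \<tau>)" using px by (simp add: b_def)
      have "pmf D (x, \<tau>) - pmf D (x, - \<tau>) \<le> p x" "0 \<le> pmf D (x, \<tau>) - pmf D (x, - \<tau>)"
        by (auto simp: \<tau>_def p_def)
      then have b: "0 \<le> b" "b \<le> 1" using px by (simp_all add: b_def)
      \<comment> \<open>Ties go to -1, which is wrong for \<open>\<tau> = 1\<close> and right for
        \<open>\<tau> = -1\<close>; counting every tie as an error covers both cases.\<close>
      have "?g x z \<le> p x * b * indicator {z. votes \<tau> x z \<in> {..0}} z" for z
        unfolding pb using x by (auto simp: majority_def \<tau>_def votes_minus[of 1] indicator_def)
      then have "measure_pmf.expectation ?R (?g x)
          \<le> measure_pmf.expectation ?R (\<lambda>z. p x * b * indicator {z. votes \<tau> x z \<in> {..0}} z)"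
        by (intro integral_mono integrable_samples[OF D])
      also have "\<dots> = p x * b * measure_pmf.prob ?R {z. votes \<tau> x z \<in> {..0}}"
        by simp
      also have "measure_pmf.prob ?R {z. votes \<tau> x z \<in> {..0}}
          = measure_pmf.expectation (binomial_pmf m (p x)) (\<lambda>N. measure_pmf.prob (V_pmf N b) {..0})" (is "_ = ?E")
        using b by (intro prob_votes[OF D \<tau> _ p_def pb]) auto
      also have "p x * b * ?E \<le> c / sqrt (real m) * sqrt (p x) + K / real m"
      proof (cases "K \<le> real m * p x")
        case True
        have "p x * (b * ?E) \<le> p x * (c / sqrt (real m * p x))"
          using px p0 b True by (intro mult_left_mono bound) auto
        also have "\<dots> = c / sqrt (real m) * (p x / sqrt (p x))"
          by (simp add: real_sqrt_mult)
        also have "\<dots> = c / sqrt (real m) * sqrt (p x)"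
          using px by (simp add: real_div_sqrt)
        finally show ?thesis using K by (simp add: mult.assoc add_increasing2)
      next
        case False
        \<comment> \<open>With fewer than \<open>K\<close> expected examples at \<open>x\<close>,
          even a certain error costs at most \<open>p x\<close>, which is below K / m.\<close>
        have "?E = measure_pmf.prob ?R {z. votes \<tau> x z \<in> {..0}}"
          using b by (intro prob_votes[OF D \<tau> _ p_def pb, symmetric]) auto
        then have "p x * b * ?E \<le> p x * 1 * 1"
          using px b by (intro mult_mono) auto
        also have "\<dots> \<le> K / real m" using False m by (simp add: field_simps)
        finally show ?thesis using c0 p0 by (simp add: add_increasing)
      qed
      finally show ?thesis .
    qed
    have "risk m d (majority d) D = measure_pmf.expectation ?R (\<lambda>z. \<Sum>x\<in>{1..d}. ?g x z)"
      unfolding risk_def expectation_samples[OF D]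
      by (intro sum.cong refl) (simp add: excess_eq[OF D learnersD[OF majority_learner]])
    also have "\<dots> = (\<Sum>x\<in>{1..d}. measure_pmf.expectation ?R (?g x))"
      by (intro Bochner_Integration.integral_sum integrable_samples[OF D])
    also have "\<dots> \<le> (\<Sum>x\<in>{1..d}. c / sqrt (real m) * sqrt (p x) + K / real m)"
      by (intro sum_mono coord)
    also have "\<dots> = c / sqrt (real m) * (\<Sum>x\<in>{1..d}. sqrt (p x)) + real d * K / real m"
      by (simp add: sum.distrib sum_distrib_left)
    also have "\<dots> \<le> c / sqrt (real m) * sqrt (real d) + real d * K / real m"
    proof (intro add_right_mono mult_left_mono)
      have "(\<Sum>x\<in>{1..d}. sqrt (p x) * 1)\<^sup>2 \<le> (\<Sum>x\<in>{1..d}. (sqrt (p x))\<^sup>2) * (\<Sum>x\<in>{1..d}. 1\<^sup>2)"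
        by (rule Cauchy_Schwarz_ineq_sum)
      also have "(\<Sum>x\<in>{1..d}. (sqrt (p x))\<^sup>2) = 1"
        using sum_marginals[OF D] p0 by (simp add: p_def)
      finally show "(\<Sum>x\<in>{1..d}. sqrt (p x)) \<le> sqrt (real d)"
        by (intro real_le_rsqrt) simp
    qed (use c0 in simp)
    finally show ?thesis
      using m d by (simp add: real_sqrt_divide mult.commute)
  qed
  with K show ?thesis by blast
qed

lemma minimax_upper:
  assumes "c_infty < c" "R = minimax \<or> R = minimax_rand"
  shows "\<exists>K>0. \<forall>m d. 1 \<le> m \<longrightarrow> 1 \<le> d \<longrightarrow> R m d \<le> c / sqrt (real m / real d) + K / (real m / real d)"
proof -
  obtain K where K: "0 < K" and bound: "\<And>m d D. 1 \<le> m \<Longrightarrow> 1 \<le> d \<Longrightarrow> D \<in> distributions d \<Longrightarrow>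
    risk m d (majority d) D \<le> c / sqrt (real m / real d) + K / (real m / real d)"
    using risk_majority_le[OF assms(1)] by metis
  \<comment> \<open>Again for an abstract class: majority voting belongs to both, in the randomized
    one as an algorithm that ignores its seed. The lower bound 0 makes the real infimum
    meaningful.\<close>
  have inf: "(INF L\<in>\<L>. SUP D\<in>distributions d. r L D) \<le> c / sqrt (real m / real d) + K / (real m / real d)"
    if m: "1 \<le> m" and d: "1 \<le> d" and M: "M \<in> \<L>"
      and r: "\<And>L D. L \<in> \<L> \<Longrightarrow> D \<in> distributions d \<Longrightarrow> 0 \<le> r L D \<and> r L D \<le> (1 :: real)"
      and eq: "\<And>D. D \<in> distributions d \<Longrightarrow> r M D = risk m d (majority d) D"
    for m d and \<L> :: "'b set" and M and r :: "'b \<Rightarrow> (nat \<times> int) pmf \<Rightarrow> real"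
  proof (rule cINF_lower2[OF _ M])
    show "bdd_below ((\<lambda>L. SUP D\<in>distributions d. r L D) ` \<L>)"
    proof (rule bdd_belowI2)
      fix L assume L: "L \<in> \<L>"
      obtain D where D: "D \<in> distributions d" using distributions_nonempty[OF d] by blast
      have "bdd_above (r L ` distributions d)"
        using r[OF L] by (intro bdd_aboveI2[of _ _ 1]) auto
      then show "0 \<le> (SUP D\<in>distributions d. r L D)"
        using r[OF L D] cSUP_upper[OF D] by (meson order_trans)
    qed
    show "(SUP D\<in>distributions d. r M D) \<le> c / sqrt (real m / real d) + K / (real m / real d)"
      using bound[OF m d] by (intro cSUP_least distributions_nonempty d) (simp add: eq)
  qed
  have "R m d \<le> c / sqrt (real m / real d) + K / (real m / real d)" if "1 \<le> m" "1 \<le> d" for m d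
    using assms(2)
  proof
    assume "R = minimax"
    then show ?thesis
      unfolding minimax_def using that
      by (simp only:) (rule inf[OF _ _ majority_learner], auto intro: risk_bounds)
  next
    assume "R = minimax_rand"
    then show ?thesis
      unfolding minimax_rand_def using that
      by (simp only:) (rule inf[OF _ _ const_rand_learner[OF majority_learner]],
          auto intro: risk_rand_bounds risk_rand_const majority_learner)
  qed
  with K show ?thesis by blast
qed

theorem theorem2p16:
  fixes R :: "nat \<Rightarrow> nat \<Rightarrow> real"
  assumes "R = minimax \<or> R = minimax_rand"
  shows "(0.16997 \<le> c_infty \<and> c_infty < 0.16998) \<and>
    ((\<lambda>(m, d). (c_infty / sqrt (real m / real d)) / R m d) \<longlongrightarrow> 1) ratio_at_top \<and>
    (\<forall>m d. 1 \<le> d \<and> 3 \<le> real m / real d \<longrightarrow>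
       R m d \<ge> B0 m d \<and>
       B0 m d \<ge> B1 (real m / real d) \<and>
       B1 (real m / real d) \<ge> B2 (real m / real d) \<and>
       B2 (real m / real d) \<ge> B2_tilde (real m / real d)) \<and>
    ((\<lambda>(m, d). B2_tilde (real m / real d) / (c_infty / sqrt (real m / real d))) \<longlongrightarrow> 1) ratio_at_top"
proof -
  define \<nu> where "\<nu> = (\<lambda>(m, d). real m / real d)"
  have \<nu>: "filterlim \<nu> at_top ratio_at_top"
    unfolding \<nu>_def ratio_at_top_def by (rule filterlim_filtercomap)
  have chain: "R m d \<ge> B0 m d \<and> B0 m d \<ge> B1 (real m / real d) \<and>
      B1 (real m / real d) \<ge> B2 (real m / real d) \<and> B2 (real m / real d) \<ge> B2_tilde (real m / real d)"
    if "1 \<le> d" "3 \<le> real m / real d" for m d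
    using assms that
    by (auto intro: B0_le_minimax B0_le_minimax_rand B1_le_B0 B2_le_B1 B2_tilde_le_B2)
  \<comment> \<open>If \<open>m\<close> or \<open>d\<close> is 0 the quotient is 0, so a large
    quotient forces both to be positive.\<close>
  have big: "\<forall>\<^sub>F w in ratio_at_top. 3 \<le> \<nu> w \<and> 1 \<le> fst w \<and> 1 \<le> snd w"
    using \<nu>[unfolded filterlim_at_top, rule_format, of 3]
  proof eventually_elim
    case (elim w)
    then show ?case
      by (cases "fst w = 0 \<or> snd w = 0") (auto simp: \<nu>_def case_prod_beta)
  qed
  have lower: "((\<lambda>w. B2_tilde (\<nu> w) * sqrt (\<nu> w)) \<longlongrightarrow> c_infty) ratio_at_top"
    by (rule filterlim_compose[OF tendsto_B2_tilde \<nu>])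
  have lim: "((\<lambda>w. R (fst w) (snd w) * sqrt (\<nu> w)) \<longlongrightarrow> c_infty) ratio_at_top"
  proof (rule order_tendstoI)
    fix a assume "a < c_infty"
    from order_tendstoD(1)[OF lower this] big
    show "\<forall>\<^sub>F w in ratio_at_top. a < R (fst w) (snd w) * sqrt (\<nu> w)"
    proof eventually_elim
      case (elim w)
      have "B2_tilde (\<nu> w) \<le> R (fst w) (snd w)"
        using chain[of "snd w" "fst w"] elim by (auto simp: \<nu>_def case_prod_beta)
      then have "B2_tilde (\<nu> w) * sqrt (\<nu> w) \<le> R (fst w) (snd w) * sqrt (\<nu> w)"
        using elim by (intro mult_right_mono) auto
      with elim show ?case by linarith
    qed
  next
    fix a assume a: "c_infty < a"
    define c where "c = (c_infty + a) / 2"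
    have c: "c_infty < c" "c < a" using a by (auto simp: c_def)
    obtain K where K: "0 < K" and bound: "\<And>m d. 1 \<le> m \<Longrightarrow> 1 \<le> d \<Longrightarrow>
        R m d \<le> c / sqrt (real m / real d) + K / (real m / real d)"
      using minimax_upper[OF c(1) assms] by metis
    \<comment> \<open>Multiplied by sqrt \<nu>, the error K / \<nu> of the upper bound still
      vanishes, whatever size \<open>K\<close> has for the chosen \<open>c\<close>.\<close>
    have "((\<lambda>x. c + K / sqrt x) \<longlongrightarrow> c) at_top" by real_asymp
    from filterlim_compose[OF this \<nu>]
    have "((\<lambda>w. c + K / sqrt (\<nu> w)) \<longlongrightarrow> c) ratio_at_top" .
    from order_tendstoD(2)[OF this c(2)] big
    show "\<forall>\<^sub>F w in ratio_at_top. R (fst w) (snd w) * sqrt (\<nu> w) < a"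
    proof eventually_elim
      case (elim w)
      have s: "0 < sqrt (\<nu> w)" "sqrt (\<nu> w) * sqrt (\<nu> w) = \<nu> w" using elim by auto
      have "R (fst w) (snd w) \<le> c / sqrt (\<nu> w) + K / \<nu> w"
        using bound[of "fst w" "snd w"] elim by (simp add: \<nu>_def case_prod_beta)
      then have "R (fst w) (snd w) * sqrt (\<nu> w) \<le> (c / sqrt (\<nu> w) + K / \<nu> w) * sqrt (\<nu> w)"
        using s(1) by (intro mult_right_mono) auto
      also have "\<dots> = c + K / sqrt (\<nu> w)"
      proof -
        have "K / (r * r) * r = K / r" if "r \<noteq> 0" for r :: real using that by simp
        from this[of "sqrt (\<nu> w)"] show ?thesis using s by (simp add: distrib_right)
      qed
      finally show ?case using elim by linarith
    qed
  qed
  have "((\<lambda>w. c_infty / (R (fst w) (snd w) * sqrt (\<nu> w))) \<longlongrightarrow> c_infty / c_infty) ratio_at_top"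
    using c_infty_pos by (intro tendsto_intros lim) auto
  then have 1: "((\<lambda>(m, d). (c_infty / sqrt (real m / real d)) / R m d) \<longlongrightarrow> 1) ratio_at_top"
    using c_infty_pos by (simp add: \<nu>_def case_prod_unfold mult.commute)
  have "((\<lambda>w. B2_tilde (\<nu> w) * sqrt (\<nu> w) / c_infty) \<longlongrightarrow> c_infty / c_infty) ratio_at_top"
    using c_infty_pos by (intro tendsto_intros lower) auto
  then have 2: "((\<lambda>(m, d). B2_tilde (real m / real d) / (c_infty / sqrt (real m / real d))) \<longlongrightarrow> 1) ratio_at_top"
    using c_infty_pos by (simp add: \<nu>_def case_prod_unfold)
  from c_infty_lower c_infty_upper 1 2 chain show ?thesis by blast
qed

end
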